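(* Let $I=(F_1,\ldots,F_r)\subseteq R=k[x_0,\ldots,x_n]$ be a homogeneous complete intersection of type $(d_1,\ldots,d_r)$, and let $s\geq 1$ be an integer. Then the graded minimal free resolution of $I^s$ has the form \[ 0 \rightarrow \mathcal{H}_{r-1} \rightarrow \mathcal{H}_{r-2} \rightarrow \cdots \rightarrow \mathcal{H}_{0} \rightarrow I^s \rightarrow 0 \] where \[ \mathcal{H}_0 = \bigoplus_{(a_1,\ldots,a_r) \in \mathcal{M}_{r,s,1}} R(-a_1d_1-\cdots-a_rd_r) \] and, for $i=1,\ldots,r-1$, \[ \mathcal{H}_i = \bigoplus_{l_1 = i+1}^r \left[\bigoplus_{l_2=l_1}^{r}\left[\cdots \left[ \bigoplus_{l_i=l_{i-1}}^r \left[\bigoplus_{(a_1,\ldots,a_r) \in \mathcal{M}_{r,s+i,l_i}} R(-a_1d_1-\cdots-a_rd_r)\right]\right]\cdots\right]\right]. \]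
   Context: $k$ is an infinite field of characteristic $0$ and $R=k[x_0,\ldots,x_n]$ has the standard grading; $R(-d)$ denotes the graded free module of rank one with generator in degree $d$. A homogeneous ideal $I=(F_1,\ldots,F_r)\subseteq R$ is a complete intersection of type $(d_1,\ldots,d_r)$ if $F_1,\ldots,F_r$ is a regular sequence on $R$ of homogeneous forms with $\deg F_i=d_i$; the forms are ordered so that $d_1\leq d_2\leq\cdots\leq d_r$. $\mathbb{N}$ is the set of non-negative integers. For positive integers $r,s,t$, \[ \mathcal{M}_{r,s,t} := \{(a_1,\ldots,a_r)\in\mathbb{N}^r \mid a_1+\cdots+a_r=s \text{ and at least } t \text{ of the } a_i\text{'s are non-zero}\}. \] In the formula for $\mathcal{H}_i$ the outer direct sum is over all integer sequences $(l_1,\ldots,l_i)$ with $i+1\leq l_1\leq l_2\leq\cdots\leq l_i\leq r$. *)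

theory Defs
  imports Complex_Main "HOL-Library.Poly_Mapping" "HOL-Library.Function_Algebras" "HOL-Library.FuncSet"
begin

section \<open>Ideals and regular sequences\<close>

lemma module_times: "module ((*) :: 'a::comm_ring_1 \<Rightarrow> 'a \<Rightarrow> 'a)"
  by (rule module.intro) (simp_all add: algebra_simps)

abbreviation ideal_span :: "'a::comm_ring_1 set \<Rightarrow> 'a set" where
  "ideal_span \<equiv> module.span (*)"

definition ideal_power :: "'a::comm_ring_1 set \<Rightarrow> nat \<Rightarrow> 'a set" where
  "ideal_power J s = ideal_span {\<Prod>i<s. f i |f. \<forall>i<s. f i \<in> J}"

definition regular_sequence :: "'a::comm_ring_1 list \<Rightarrow> bool" where
  "regular_sequence Fs \<longleftrightarrow>
     (\<forall>j<length Fs. \<forall>g. Fs ! j * g \<in> ideal_span (set (take j Fs))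
                        \<longrightarrow> g \<in> ideal_span (set (take j Fs))) \<and>
     ideal_span (set Fs) \<noteq> UNIV"


section \<open>The standard graded polynomial ring\<close>

text \<open>The variables are the elements of a finite (hence nonempty) index type \<open>'v\<close>; thus
  \<open>CARD('v) = n + 1\<close> for the ring \<open>k[x_0, ..., x_n]\<close>.\<close>

type_synonym ('v, 'k) mpoly = "('v \<Rightarrow>\<^sub>0 nat) \<Rightarrow>\<^sub>0 'k"

definition variable :: "'v \<Rightarrow> ('v, 'k::comm_ring_1) mpoly" where
  "variable x = Poly_Mapping.single (Poly_Mapping.single x 1) 1"

definition irrelevant_ideal :: "('v, 'k::comm_ring_1) mpoly set" where
  "irrelevant_ideal = ideal_span (range variable)"

definition monomial_degree :: "('v::finite \<Rightarrow>\<^sub>0 nat) \<Rightarrow> nat" where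
  "monomial_degree m = (\<Sum>x\<in>UNIV. Poly_Mapping.lookup m x)"

text \<open>The component \<open>R_e\<close>. It contains \<open>0\<close>, and it is \<open>{0}\<close> for negative \<open>e\<close>.\<close>

definition forms :: "int \<Rightarrow> ('v::finite, 'k::comm_ring_1) mpoly set" where
  "forms e = {p. \<forall>m\<in>Poly_Mapping.keys p. int (monomial_degree m) = e}"

text \<open>Regularity forces every \<open>Fs ! j\<close> to be nonzero, so \<open>ds ! j\<close> is its degree.\<close>

definition complete_intersection ::
    "('v::finite, 'k::field) mpoly list \<Rightarrow> nat list \<Rightarrow> bool" where
  "complete_intersection Fs ds \<longleftrightarrow>
     length Fs = length ds \<and> sorted ds \<and> regular_sequence Fs \<and>
     (\<forall>j<length Fs. Fs ! j \<in> forms (int (ds ! j)))"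


section \<open>Graded free modules and minimal graded free resolutions\<close>

text \<open>For a finite set \<open>B\<close> and \<open>deg :: 'b \<Rightarrow> int\<close>, the graded module \<open>\<Oplus>b\<in>B. R(-deg b)\<close> is
  \<open>free_module B\<close> with the components \<open>free_component B deg e\<close>, using
  \<open>R(-d)_e = R_(e - d)\<close>. Addition of elements is the pointwise one.\<close>

definition free_module :: "'b set \<Rightarrow> ('b \<Rightarrow> 'r::zero) set" where
  "free_module B = {u. \<forall>b. b \<notin> B \<longrightarrow> u b = 0}"

definition free_component ::
    "'b set \<Rightarrow> ('b \<Rightarrow> int) \<Rightarrow> int \<Rightarrow> ('b \<Rightarrow> ('v::finite, 'k::comm_ring_1) mpoly) set" where
  "free_component B deg e = {u \<in> free_module B. \<forall>b\<in>B. u b \<in> forms (e - deg b)}"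

definition free_scale :: "'r::times \<Rightarrow> ('b \<Rightarrow> 'r) \<Rightarrow> ('b \<Rightarrow> 'r)" where
  "free_scale c u = (\<lambda>b. c * u b)"

text \<open>Homomorphisms of degree 0 from the graded module \<open>M\<close> (scalar multiplication \<open>scM\<close>,
  components \<open>grM e\<close>) to the graded module \<open>N\<close>.\<close>

definition graded_hom ::
    "('r \<Rightarrow> 'm::plus \<Rightarrow> 'm) \<Rightarrow> 'm set \<Rightarrow> (int \<Rightarrow> 'm set) \<Rightarrow>
     ('r \<Rightarrow> 'n::plus \<Rightarrow> 'n) \<Rightarrow> 'n set \<Rightarrow> (int \<Rightarrow> 'n set) \<Rightarrow> ('m \<Rightarrow> 'n) \<Rightarrow> bool" where
  "graded_hom scM M grM scN N grN f \<longleftrightarrow>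
     f \<in> M \<rightarrow> N \<and>
     (\<forall>u\<in>M. \<forall>w\<in>M. f (u + w) = f u + f w) \<and>
     (\<forall>c. \<forall>u\<in>M. f (scM c u) = scN c (f u)) \<and>
     (\<forall>e. f ` grM e \<subseteq> grN e)"

text \<open>The resolution is \<open>0 \<rightarrow> G_N \<rightarrow> ... \<rightarrow> G_0 \<rightarrow> J \<rightarrow> 0\<close> with \<open>G_i = \<Oplus>b\<in>B i. R(-deg i b)\<close>,
  differentials \<open>\<phi> (i + 1) : G_(i + 1) \<rightarrow> G_i\<close> and augmentation \<open>\<epsilon> : G_0 \<rightarrow> J\<close>. The sets \<open>B i\<close> are
  empty, that is \<open>G_i = 0\<close>, for \<open>i > N\<close>, so exactness at \<open>G_N\<close> is injectivity. The value \<open>\<phi> 0\<close> is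
  unused. Minimality is \<open>\<phi> (i + 1) G_(i + 1) \<subseteq> \<mm> G_i\<close>, where \<open>\<mm> G_i\<close> consists of the elements of
  \<open>G_i\<close> with all coordinates in \<open>\<mm> = (x_0, ..., x_n)\<close>.\<close>

definition minimal_graded_free_resolution ::
    "nat \<Rightarrow> (nat \<Rightarrow> 'b set) \<Rightarrow> (nat \<Rightarrow> 'b \<Rightarrow> int) \<Rightarrow>
     (nat \<Rightarrow> ('b \<Rightarrow> ('v::finite, 'k::field) mpoly) \<Rightarrow> ('b \<Rightarrow> ('v, 'k) mpoly)) \<Rightarrow>
     (('b \<Rightarrow> ('v, 'k) mpoly) \<Rightarrow> ('v, 'k) mpoly) \<Rightarrow> ('v, 'k) mpoly set \<Rightarrow> bool" where
  "minimal_graded_free_resolution N B deg \<phi> \<epsilon> J \<longleftrightarrow>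
     (\<forall>i. finite (B i)) \<and> (\<forall>i>N. B i = {}) \<and>
     (\<forall>i. graded_hom
            free_scale (free_module (B (Suc i))) (free_component (B (Suc i)) (deg (Suc i)))
            free_scale (free_module (B i)) (free_component (B i) (deg i))
            (\<phi> (Suc i))) \<and>
     graded_hom
       free_scale (free_module (B 0)) (free_component (B 0) (deg 0))
       (*) J (\<lambda>e. J \<inter> forms e) \<epsilon> \<and>
     \<epsilon> ` free_module (B 0) = J \<and>
     {u \<in> free_module (B 0). \<epsilon> u = 0} = \<phi> 1 ` free_module (B 1) \<and>
     (\<forall>i\<ge>1. {u \<in> free_module (B i). \<phi> i u = 0} = \<phi> (Suc i) ` free_module (B (Suc i))) \<and>
     (\<forall>i. \<forall>u\<in>free_module (B (Suc i)). \<forall>b. \<phi> (Suc i) u b \<in> irrelevant_ideal)"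


section \<open>The index sets of the direct sums\<close>

definition M_set :: "nat \<Rightarrow> nat \<Rightarrow> nat \<Rightarrow> nat list set" where
  "M_set r s t = {a. length a = r \<and> sum_list a = s \<and> t \<le> card {j. j < r \<and> a ! j \<noteq> 0}}"

text \<open>The iterated direct sum \<open>H_i\<close> has one summand for each pair \<open>(l, a)\<close> of a sequence
  \<open>l = (l_1, ..., l_i)\<close> with \<open>i + 1 \<le> l_1 \<le> ... \<le> l_i \<le> r\<close> and an \<open>a\<close> in \<open>M_(r, s+i, l_i)\<close>. For
  \<open>i = 0\<close> the sequence \<open>l\<close> is empty and \<open>a\<close> ranges over \<open>M_(r, s, 1)\<close>.\<close>

definition H_index :: "nat \<Rightarrow> nat \<Rightarrow> nat \<Rightarrow> (nat list \<times> nat list) set" where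
  "H_index r s i =
     {(l, a). length l = i \<and> sorted l \<and> set l \<subseteq> {i + 1..r} \<and>
              a \<in> M_set r (s + i) (if i = 0 then 1 else last l)}"

definition H_degree :: "nat list \<Rightarrow> nat list \<times> nat list \<Rightarrow> int" where
  "H_degree ds = (\<lambda>(l, a). int (\<Sum>j<length ds. a ! j * ds ! j))"

end

(* Let I_r be generated by the first r forms and write G(r,s) for the resolution of I_r^s. Since F_r
   is regular modulo every power of I_(r-1), the intersection of I_(r-1)^s and F_r I_r^(s-1) is
   F_r I_(r-1)^s, so there is an exact sequence
     0 -> I_(r-1)^s -> I_(r-1)^s + I_r^(s-1) -> I_r^s -> 0    (direct sum in the middle)
   with first map a |-> (F_r a, -a), and G(r,s) is the mapping cone of
   (F_r, -restr) : G(r-1,s) -> G(r-1,s) + G(r,s-1).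
   Here restr lifts the inclusion of I_(r-1)^s in I_r^(s-1). It has an explicit recursive form whose
   entries are 0 or one of the F_j, so the differentials have entries in I_r and the resolution is
   minimal. Regularity modulo powers comes from the same induction: if g is regular modulo I and
   g x is in I^(s+1), write x = aug c; then g c differs from an element with coordinates in I by a
   boundary, whose coordinates lie in I as well, hence c has coordinates in I.
   The cone has, for each exponent vector a with p nonzero entries, (p-1 choose i) basis elements in
   degree i, which is also the number of sequences l in the iterated direct sum. *)

theory Submission imports Defs "HOL-Library.Multiset" begin

section \<open>Ideals and their powers\<close>

abbreviation is_ideal :: "'a::comm_ring_1 set \<Rightarrow> bool" where
  "is_ideal \<equiv> module.subspace (*)"

lemmas ideal_subspace_0 = module.subspace_0[OF module_times]
lemmas ideal_subspace_add = module.subspace_add[OF module_times]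
lemmas ideal_subspace_scale = module.subspace_scale[OF module_times]
lemmas ideal_subspace_neg = module.subspace_neg[OF module_times]
lemmas ideal_subspace_diff = module.subspace_diff[OF module_times]
lemmas ideal_subspace_span = module.subspace_span[OF module_times]
lemmas ideal_span_base = module.span_base[OF module_times]
lemmas ideal_span_add = module.span_add[OF module_times]
lemmas ideal_span_scale = module.span_scale[OF module_times]
lemmas ideal_span_zero = module.span_zero[OF module_times]
lemmas ideal_span_minimal = module.span_minimal[OF module_times]
lemmas ideal_span_mono = module.span_mono[OF module_times]
lemmas ideal_span_induct_alt [consumes 1, case_names base step] = module.span_induct_alt[OF module_times]
lemmas ideal_span_breakdown_eq = module.span_breakdown_eq[OF module_times]

lemma ideal_power_0 [simp]: "ideal_power J 0 = UNIV"
proof -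
  have "x * 1 \<in> ideal_power J 0" for x
    unfolding ideal_power_def by (intro ideal_span_scale ideal_span_base) simp
  then show ?thesis by auto
qed

lemma is_ideal_ideal_power [simp]: "is_ideal (ideal_power J s)"
  by (simp add: ideal_power_def ideal_subspace_span)

lemmas ideal_power_add = ideal_subspace_add[OF is_ideal_ideal_power]
lemmas ideal_power_scale = ideal_subspace_scale[OF is_ideal_ideal_power]

lemma ideal_power_mult:
  assumes a: "a \<in> J" and b: "b \<in> ideal_power J s"
  shows "a * b \<in> ideal_power J (Suc s)"
  using b unfolding ideal_power_def[of J s]
proof (induction rule: ideal_span_induct_alt)
  case base
  then show ?case by (simp add: ideal_subspace_0)
next
  case (step c x y)
  from step.hyps obtain f where f: "x = (\<Prod>i<s. f i)" "\<forall>i<s. f i \<in> J" by blast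
  let ?g = "\<lambda>i. if i < s then f i else a"
  have "a * x = (\<Prod>i<Suc s. ?g i)"
    by (simp add: f(1) mult.commute)
  moreover have "\<forall>i<Suc s. ?g i \<in> J" using f(2) a by simp
  ultimately have "a * x \<in> {\<Prod>i<Suc s. f i |f. \<forall>i<Suc s. f i \<in> J}" by blast
  then have "a * x \<in> ideal_power J (Suc s)"
    unfolding ideal_power_def by (rule ideal_span_base)
  then have "c * (a * x) + a * y \<in> ideal_power J (Suc s)"
    using step.IH ideal_power_add ideal_power_scale by blast
  then show ?case by (simp add: algebra_simps)
qed

text \<open>Together with \<open>ideal_power_mult\<close> this makes J^(s+1) the smallest ideal
  containing the products of an element of J and one of J^s. Later inductions thus split off one
  factor at a time.\<close>

lemma ideal_power_Suc_subset:
  assumes K: "is_ideal K" and prod: "\<And>a b. a \<in> J \<Longrightarrow> b \<in> ideal_power J s \<Longrightarrow> a * b \<in> K"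
  shows "ideal_power J (Suc s) \<subseteq> K"
  unfolding ideal_power_def
proof (rule ideal_span_minimal[OF _ K], clarify)
  fix f :: "nat \<Rightarrow> 'a" assume f: "\<forall>i<Suc s. f i \<in> J"
  have "(\<Prod>i<s. f i) \<in> ideal_power J s"
    unfolding ideal_power_def by (rule ideal_span_base) (use f in auto)
  then have "f s * (\<Prod>i<s. f i) \<in> K" using f by (intro prod) auto
  then show "(\<Prod>i<Suc s. f i) \<in> K" by (simp add: mult.commute)
qed

lemma ideal_power_mono: "J \<subseteq> J' \<Longrightarrow> ideal_power J s \<subseteq> ideal_power J' s"
  unfolding ideal_power_def by (intro ideal_span_mono) blast

lemma ideal_power_decreasing: "ideal_power J (Suc s) \<subseteq> ideal_power J s"
  by (rule ideal_power_Suc_subset) (auto intro: ideal_power_scale)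


section \<open>The iterated mapping cone\<close>

text \<open>A word indexes a basis element of \<open>G(r, s)\<close> by the path of the recursion leading to it:
  \<open>Skip\<close> goes to the summand \<open>G(r - 1, s)\<close>, \<open>Mult\<close> to \<open>G(r, s - 1)\<close> and \<open>Cone\<close> to the shifted
  copy of \<open>G(r - 1, s)\<close>, so that the homological degree is the number of letters \<open>Cone\<close>. The
  functions below act on all homological degrees at once; \<open>aug\<close> ignores positive degrees.\<close>

datatype step = Skip | Mult | Cone

fun words :: "nat \<Rightarrow> nat \<Rightarrow> step list set" where
  "words r 0 = {[]}"
| "words 0 (Suc s) = {}"
| "words (Suc r) (Suc s) =
     (#) Skip ` words r (Suc s) \<union> (#) Mult ` words (Suc r) s \<union> (#) Cone ` words r (Suc s)"

fun glue :: "(step list \<Rightarrow> 'a::zero) \<Rightarrow> (step list \<Rightarrow> 'a) \<Rightarrow> (step list \<Rightarrow> 'a) \<Rightarrow> step list \<Rightarrow> 'a" where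
  "glue x y z [] = 0"
| "glue x y z (Skip # v) = x v"
| "glue x y z (Mult # v) = y v"
| "glue x y z (Cone # v) = z v"

text \<open>The inclusion of G(r, s) as a subcomplex of G(r + 1, s). For s > 0 it is the
  \<open>Skip\<close> summand; for s = 0 both complexes are R on the empty word, hence the
  identity.\<close>

fun incl :: "nat \<Rightarrow> (step list \<Rightarrow> 'a::zero) \<Rightarrow> step list \<Rightarrow> 'a" where
  "incl 0 u = u"
| "incl (Suc s) u = glue u (\<lambda>_. 0) (\<lambda>_. 0)"

text \<open>A chain map from G(r, s + 1) to G(r, s) over the inclusion of I_r^(s+1) in I_r^s;
  following it with \<open>incl s\<close> gives the map used in the cone. Forms are numbered from 0,
  so passing to \<open>Suc r\<close> adjoins \<open>F r\<close>. The augmentation of the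
  \<open>Mult\<close> summand carries a factor \<open>F r\<close>, so the inclusion acts there as
  multiplication by \<open>F r\<close>; the \<open>Cone\<close> summand goes to 0.\<close>

fun restr :: "(nat \<Rightarrow> 'a::comm_ring_1) \<Rightarrow> nat \<Rightarrow> nat \<Rightarrow> (step list \<Rightarrow> 'a) \<Rightarrow> step list \<Rightarrow> 'a" where
  "restr F 0 s u = (\<lambda>_. 0)"
| "restr F (Suc r) s u =
     (\<lambda>w. incl s (restr F r s (\<lambda>v. u (Skip # v))) w + F r * u (Mult # w))"

text \<open>The differential of the mapping cone in coordinates: a \<open>Cone\<close> coordinate z
  contributes \<open>F r * z\<close> to \<open>Skip\<close>, minus its restriction to
  \<open>Mult\<close> and, because of the shift, minus its own differential to
  \<open>Cone\<close>.\<close>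

fun diff :: "(nat \<Rightarrow> 'a::comm_ring_1) \<Rightarrow> nat \<Rightarrow> nat \<Rightarrow> (step list \<Rightarrow> 'a) \<Rightarrow> step list \<Rightarrow> 'a" where
  "diff F r 0 u = (\<lambda>_. 0)"
| "diff F 0 (Suc s) u = (\<lambda>_. 0)"
| "diff F (Suc r) (Suc s) u =
     glue (\<lambda>v. diff F r (Suc s) (\<lambda>v. u (Skip # v)) v + F r * u (Cone # v))
          (\<lambda>v. diff F (Suc r) s (\<lambda>v. u (Mult # v)) v - incl s (restr F r s (\<lambda>v. u (Cone # v))) v)
          (\<lambda>v. - diff F r (Suc s) (\<lambda>v. u (Cone # v)) v)"

fun aug :: "(nat \<Rightarrow> 'a::comm_ring_1) \<Rightarrow> nat \<Rightarrow> nat \<Rightarrow> (step list \<Rightarrow> 'a) \<Rightarrow> 'a" where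
  "aug F r 0 u = u []"
| "aug F 0 (Suc s) u = 0"
| "aug F (Suc r) (Suc s) u =
     aug F r (Suc s) (\<lambda>v. u (Skip # v)) + F r * aug F (Suc r) s (\<lambda>v. u (Mult # v))"

section \<open>Linearity of the maps\<close>

lemma word_cases [case_names Nil Skip Mult Cone]:
  obtains "w = []" | v where "w = Skip # v" | v where "w = Mult # v" | v where "w = Cone # v"
  by (metis list.exhaust step.exhaust)

lemma glue_ext:
  assumes "u [] = u' []" "\<And>v. u (Skip # v) = u' (Skip # v)" "\<And>v. u (Mult # v) = u' (Mult # v)"
    "\<And>v. u (Cone # v) = u' (Cone # v)"
  shows "u = u'"
proof
  fix w show "u w = u' w" by (cases w rule: word_cases) (use assms in auto)
qed

text \<open>Two-term linear combinations let a single argument per map cover sums, differences,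
  multiples and zero, by specializing the coefficients.\<close>

lemma incl_lin: "incl s (\<lambda>v. a * u v + b * w v) = (\<lambda>v. a * incl s u v + b * (incl s w v :: 'a::comm_ring_1))"
proof (cases s)
  case (Suc s')
  show ?thesis unfolding Suc by (rule glue_ext) simp_all
qed simp

lemma restr_lin: "restr F r s (\<lambda>v. a * u v + b * w v) = (\<lambda>v. a * restr F r s u v + b * restr F r s w v)"
proof (induction r arbitrary: u w)
  case (Suc r)
  show ?case by (simp add: Suc incl_lin algebra_simps)
qed simp

lemma diff_lin: "diff F r s (\<lambda>v. a * u v + b * w v) = (\<lambda>v. a * diff F r s u v + b * diff F r s w v)"
proof (induction r s arbitrary: u w rule: words.induct)
  case (3 r s)
  show ?case
    by (rule glue_ext) (simp_all add: 3 restr_lin incl_lin algebra_simps)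
qed simp_all

lemma aug_lin: "aug F r s (\<lambda>v. a * u v + b * w v) = a * aug F r s u + b * aug F r s w"
proof (induction r s arbitrary: u w rule: words.induct)
  case (3 r s)
  show ?case by (simp add: 3 algebra_simps)
qed simp_all

lemma diff_add: "diff F r s (\<lambda>v. u v + w v) = (\<lambda>v. diff F r s u v + diff F r s w v)"
  using diff_lin[of F r s 1 u 1 w] by simp
lemma diff_minus: "diff F r s (\<lambda>v. u v - w v) = (\<lambda>v. diff F r s u v - diff F r s w v)"
  using diff_lin[of F r s 1 u "-1" w] by simp
lemma diff_scale: "diff F r s (\<lambda>v. a * u v) = (\<lambda>v. a * diff F r s u v)"
  using diff_lin[of F r s a u 0 u] by simp
lemma diff_uminus: "diff F r s (\<lambda>v. - u v) = (\<lambda>v. - diff F r s u v)"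
  using diff_scale[of F r s "-1" u] by simp
lemma diff_zero [simp]: "diff F r s (\<lambda>v. 0) = (\<lambda>v. 0)"
  using diff_scale[of F r s 0] by simp
lemma aug_add: "aug F r s (\<lambda>v. u v + w v) = aug F r s u + aug F r s w"
  using aug_lin[of F r s 1 u 1 w] by simp
lemma aug_minus: "aug F r s (\<lambda>v. u v - w v) = aug F r s u - aug F r s w"
  using aug_lin[of F r s 1 u "-1" w] by simp
lemma aug_scale: "aug F r s (\<lambda>v. a * u v) = a * aug F r s u"
  using aug_lin[of F r s a u 0 u] by simp
lemma aug_zero [simp]: "aug F r s (\<lambda>v. 0) = 0"
  using aug_scale[of F r s 0] by simp
lemma restr_add: "restr F r s (\<lambda>v. u v + w v) = (\<lambda>v. restr F r s u v + restr F r s w v)"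
  using restr_lin[of F r s 1 u 1 w] by simp
lemma restr_scale: "restr F r s (\<lambda>v. a * u v) = (\<lambda>v. a * restr F r s u v)"
  using restr_lin[of F r s a u 0 u] by simp
lemma restr_uminus: "restr F r s (\<lambda>v. - u v) = (\<lambda>v. - restr F r s u v)"
  using restr_scale[of F r s "-1" u] by simp
lemma restr_zero [simp]: "restr F r s (\<lambda>v. 0) = (\<lambda>v. 0)"
  using restr_scale[of F r s 0] by simp
lemma incl_zero [simp]: "incl s (\<lambda>v. 0) = (\<lambda>v. 0)"
proof (cases s)
  case (Suc s')
  show ?thesis unfolding Suc by (rule glue_ext) simp_all
qed simp
lemma incl_uminus: "incl s (\<lambda>v. - u v) = (\<lambda>v. - incl s u v :: 'a::comm_ring_1)"
  using incl_lin[of s "-1" u 0 u] by simp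
lemma incl_add: "incl s (\<lambda>v. u v + w v) = (\<lambda>v. incl s u v + incl s w v :: 'a::comm_ring_1)"
  using incl_lin[of s 1 u 1 w] by simp
lemma incl_scale: "incl s (\<lambda>v. a * u v) = (\<lambda>v. a * incl s u v :: 'a::comm_ring_1)"
  using incl_lin[of s a u 0 u] by simp

section \<open>Chain map identities and the complex property\<close>

lemma diff_incl: "diff F (Suc r) s (incl s u) = incl s (diff F r s u)"
proof (cases s)
  case (Suc s')
  show ?thesis unfolding Suc by (rule glue_ext) simp_all
qed simp

lemma aug_incl: "aug F (Suc r) s (incl s u) = aug F r s u"
  by (cases s) auto

text \<open>On the right-hand side the \<open>Cone\<close> coordinate enters twice, through
  \<open>Skip\<close> and through \<open>Mult\<close>, as plus and minus \<open>F r\<close> times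
  its restriction, and cancels. The remaining terms agree by induction and
  \<open>diff_incl\<close>.\<close>

lemma diff_restr: "diff F r s (restr F r s u) = restr F r s (diff F r (Suc s) u)"
proof (induction r arbitrary: u)
  case (Suc r)
  show ?case
    by (simp add: diff_add diff_scale diff_incl Suc restr_add restr_scale incl_add incl_scale
        algebra_simps)
qed simp

lemma aug_restr: "aug F r s (restr F r s u) = aug F r (Suc s) u"
  by (induction r arbitrary: u) (simp_all add: aug_add aug_scale aug_incl)

text \<open>The \<open>Cone\<close> coordinate contributes \<open>F r\<close> times its augmentation
  through \<open>Skip\<close> and the negative of this through \<open>Mult\<close>, since
  restriction preserves augmentations.\<close>

lemma aug_diff: "aug F r s (diff F r s u) = 0"
proof (induction r s arbitrary: u rule: words.induct)
  case (3 r s)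
  show ?case
    by (simp add: 3 aug_add aug_minus aug_scale aug_incl aug_restr)
qed simp_all

text \<open>Beyond the induction hypothesis, the \<open>Mult\<close> coordinate needs that
  \<open>incl\<close> after \<open>restr\<close> is a chain map; the \<open>Skip\<close> coordinate
  needs linearity.\<close>

lemma diff_diff: "diff F r s (diff F r s u) = (\<lambda>_. 0)"
proof (induction r s arbitrary: u rule: words.induct)
  case (3 r s)
  show ?case
    by (rule glue_ext)
      (simp_all add: 3 diff_add diff_minus diff_scale diff_uminus diff_incl diff_restr
        restr_uminus incl_uminus)
qed simp_all

section \<open>Free modules on words and their stability under the maps\<close>

lemma words_Suc_Suc [simp]:
  "[] \<notin> words (Suc r) (Suc s)"
  "Skip # v \<in> words (Suc r) (Suc s) \<longleftrightarrow> v \<in> words r (Suc s)"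
  "Mult # v \<in> words (Suc r) (Suc s) \<longleftrightarrow> v \<in> words (Suc r) s"
  "Cone # v \<in> words (Suc r) (Suc s) \<longleftrightarrow> v \<in> words r (Suc s)"
  by auto

declare words.simps(3) [simp del]

lemma finite_words: "finite (words r s)"
  by (induction r s rule: words.induct) (simp_all add: words.simps(3))

lemma free_module_words_Suc:
  "u \<in> free_module (words (Suc r) (Suc s)) \<longleftrightarrow>
     u [] = 0 \<and> (\<lambda>v. u (Skip # v)) \<in> free_module (words r (Suc s)) \<and>
     (\<lambda>v. u (Mult # v)) \<in> free_module (words (Suc r) s) \<and>
     (\<lambda>v. u (Cone # v)) \<in> free_module (words r (Suc s))" (is "?L \<longleftrightarrow> ?R")
proof
  assume ?R
  show ?L unfolding free_module_def
  proof clarify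
    fix w assume "w \<notin> words (Suc r) (Suc s)"
    with \<open>?R\<close> show "u w = 0"
      by (cases w rule: word_cases) (auto simp: free_module_def)
  qed
qed (auto simp: free_module_def)

lemma free_module_add:
  "u \<in> free_module B \<Longrightarrow> w \<in> free_module B \<Longrightarrow> (\<lambda>v. u v + w v :: 'a::comm_ring_1) \<in> free_module B"
  and free_module_minus:
  "u \<in> free_module B \<Longrightarrow> w \<in> free_module B \<Longrightarrow> (\<lambda>v. u v - w v :: 'a::comm_ring_1) \<in> free_module B"
  and free_module_uminus:
  "u \<in> free_module B \<Longrightarrow> (\<lambda>v. - u v :: 'a::comm_ring_1) \<in> free_module B"
  and free_module_scale:
  "u \<in> free_module B \<Longrightarrow> (\<lambda>v. a * u v :: 'a::comm_ring_1) \<in> free_module B"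
  and free_module_zero [simp]: "(\<lambda>v. 0 :: 'a::comm_ring_1) \<in> free_module B"
  by (simp_all add: free_module_def)

lemma incl_in_free_module:
  "u \<in> free_module (words r s) \<Longrightarrow> incl s u \<in> free_module (words (Suc r) s)"
  for u :: "step list \<Rightarrow> 'a::comm_ring_1"
  by (cases s) (simp_all add: free_module_words_Suc)

lemma restr_in_free_module:
  "u \<in> free_module (words r (Suc s)) \<Longrightarrow> restr F r s u \<in> free_module (words r s)"
  by (induction r arbitrary: u)
    (simp_all add: free_module_words_Suc free_module_add free_module_scale incl_in_free_module)

lemma diff_in_free_module:
  "u \<in> free_module (words r s) \<Longrightarrow> diff F r s u \<in> free_module (words r s)"
  by (induction r s arbitrary: u rule: words.induct)
    (simp_all add: free_module_words_Suc free_module_add free_module_minus free_module_uminus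
      free_module_scale incl_in_free_module restr_in_free_module)

lemma glue_in:
  assumes "0 \<in> A" "\<And>v. x v \<in> A" "\<And>v. y v \<in> A" "\<And>v. z v \<in> A"
  shows "glue x y z w \<in> A"
  by (cases w rule: word_cases) (simp_all add: assms)

section \<open>Coordinates in an ideal that contains the forms\<close>

lemma incl_in: "0 \<in> A \<Longrightarrow> (\<And>v. u v \<in> A) \<Longrightarrow> incl s u w \<in> A"
  by (cases s) (simp_all add: glue_in)

lemma ideal_mult_left: "is_ideal K \<Longrightarrow> a \<in> K \<Longrightarrow> a * b \<in> K"
  by (metis ideal_subspace_scale mult.commute)

lemma restr_in_ideal:
  assumes K: "is_ideal K" and F: "\<And>j. j < r \<Longrightarrow> F j \<in> K"
  shows "restr F r s u w \<in> K"
  using F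
proof (induction r arbitrary: u w)
  case (Suc r)
  have "incl s (restr F r s (\<lambda>v. u (Skip # v))) w \<in> K"
    by (rule incl_in) (use Suc in \<open>auto intro: ideal_subspace_0[OF K]\<close>)
  then show ?case
    using Suc.prems[of r] by (simp add: ideal_subspace_add[OF K] ideal_mult_left[OF K])
qed (simp add: ideal_subspace_0[OF K])

text \<open>Each matrix entry of \<open>diff\<close> is 0 or, up to sign, one of the forms. Taking
  the irrelevant ideal for K gives minimality; taking \<open>initial_ideal F r\<close> serves
  regularity modulo powers.\<close>

lemma diff_in_ideal:
  assumes K: "is_ideal K" and F: "\<And>j. j < r \<Longrightarrow> F j \<in> K"
  shows "diff F r s u w \<in> K"
  using F
proof (induction r s arbitrary: u w rule: words.induct)
  case (3 r s)
  note IH1 = "3.IH"(1) and IH2 = "3.IH"(2)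
  show ?case
    unfolding diff.simps
  proof (rule glue_in)
    show "diff F r (Suc s) (\<lambda>v. u (Skip # v)) v + F r * u (Cone # v) \<in> K" for v
      using IH1 3(4) by (simp add: ideal_subspace_add[OF K] ideal_mult_left[OF K])
    have "restr F r s (\<lambda>v. u (Cone # v)) v \<in> K" for v
      by (rule restr_in_ideal[OF K]) (simp add: 3(4))
    then have "incl s (restr F r s (\<lambda>v. u (Cone # v))) v \<in> K" for v
      by (intro incl_in ideal_subspace_0[OF K])
    then show "diff F (Suc r) s (\<lambda>v. u (Mult # v)) v - incl s (restr F r s (\<lambda>v. u (Cone # v))) v \<in> K" for v
      using IH2 3(4) by (simp add: ideal_subspace_diff[OF K])
    show "- diff F r (Suc s) (\<lambda>v. u (Cone # v)) v \<in> K" for v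
      using IH1 3(4) by (simp add: ideal_subspace_neg[OF K])
  qed (rule ideal_subspace_0[OF K])
qed (simp_all add: ideal_subspace_0[OF K])

section \<open>The homological degree\<close>

abbreviation cones :: "step list \<Rightarrow> nat" where
  "cones w \<equiv> count_list w Cone"

lemma incl_local:
  assumes "\<And>v. cones v = i \<Longrightarrow> u v = u' v" "cones w = i"
  shows "incl s u w = incl s u' w"
  using assms by (cases s; cases w rule: word_cases) auto

lemma restr_local:
  assumes "\<And>v. cones v = i \<Longrightarrow> u v = u' v" "cones w = i"
  shows "restr F r s u w = restr F r s u' w"
  using assms
proof (induction r arbitrary: u u' w)
  case (Suc r)
  have "incl s (restr F r s (\<lambda>v. u (Skip # v))) w = incl s (restr F r s (\<lambda>v. u' (Skip # v))) w"
    by (rule incl_local[OF _ Suc.prems(2)], rule Suc.IH) (simp_all add: Suc.prems)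
  then show ?case using Suc.prems by simp
qed simp

text \<open>Homogeneity of degree -1. Comparing two arguments that agree in degree i + 1 allows an
  argument to be truncated or replaced by 0.\<close>

lemma diff_local:
  assumes "\<And>v. cones v = Suc i \<Longrightarrow> u v = u' v" "cones w = i"
  shows "diff F r s u w = diff F r s u' w"
  using assms
proof (induction r s arbitrary: u u' w i rule: words.induct)
  case (3 r s)
  show ?case
  proof (cases w rule: word_cases)
    case (Skip v)
    then show ?thesis
      using "3.IH"(1)[of i "\<lambda>v. u (Skip # v)" "\<lambda>v. u' (Skip # v)" v] 3(4,5) by simp
  next
    case (Mult v)
    have "incl s (restr F r s (\<lambda>v. u (Cone # v))) v = incl s (restr F r s (\<lambda>v. u' (Cone # v))) v"
      by (rule incl_local[of i], rule restr_local[of i]) (use 3(4,5) Mult in auto)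
    then show ?thesis
      using "3.IH"(2)[of i "\<lambda>v. u (Mult # v)" "\<lambda>v. u' (Mult # v)" v] Mult 3(4,5) by simp
  next
    case (Cone v)
    then show ?thesis
      using "3.IH"(1)[of "cones v" "\<lambda>v. u (Cone # v)" "\<lambda>v. u' (Cone # v)" v] 3(4,5) by auto
  qed simp
qed simp_all

lemma aug_local:
  assumes "\<And>v. cones v = 0 \<Longrightarrow> u v = u' v"
  shows "aug F r s u = aug F r s u'"
  using assms
proof (induction r s arbitrary: u u' rule: words.induct)
  case (1 r)
  then show ?case by (simp add: "1"[of "[]"])
next
  case (3 r s)
  have "aug F r (Suc s) (\<lambda>v. u (Skip # v)) = aug F r (Suc s) (\<lambda>v. u' (Skip # v))"
    by (rule "3.IH"(1), rule "3.prems") simp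
  moreover have "aug F (Suc r) s (\<lambda>v. u (Mult # v)) = aug F (Suc r) s (\<lambda>v. u' (Mult # v))"
    by (rule "3.IH"(2), rule "3.prems") simp
  ultimately show ?case by simp
qed simp_all

definition part :: "nat \<Rightarrow> (step list \<Rightarrow> 'a::zero) \<Rightarrow> step list \<Rightarrow> 'a" where
  "part i u = (\<lambda>w. if cones w = i then u w else 0)"

lemma part_in_free_module: "u \<in> free_module B \<Longrightarrow> part i u \<in> free_module B"
  by (auto simp: free_module_def part_def)

lemma diff_part_Suc: "diff F r s (part (Suc i) u) = part i (diff F r s u)"
proof
  fix w
  \<comment> \<open>Both cases at once: on words with one \<open>Cone\<close> more than w, the
    truncation agrees with u if w has degree i, and with 0 otherwise.\<close>
  have "diff F r s (part (Suc i) u) w = diff F r s (if cones w = i then u else (\<lambda>_. 0)) w"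
    by (rule diff_local[OF _ refl]) (auto simp: part_def)
  then show "diff F r s (part (Suc i) u) w = part i (diff F r s u) w"
    by (auto simp: part_def)
qed

lemma diff_part_0: "diff F r s (part 0 u) = (\<lambda>_. 0)"
proof
  fix w
  have "diff F r s (part 0 u) w = diff F r s (\<lambda>_. 0) w"
    by (rule diff_local[OF _ refl]) (auto simp: part_def)
  then show "diff F r s (part 0 u) w = 0" by simp
qed

lemma aug_part_0: "aug F r s (part 0 u) = aug F r s u"
  by (rule aug_local) (simp add: part_def)


section \<open>Exactness\<close>

abbreviation initial_ideal :: "(nat \<Rightarrow> 'a::comm_ring_1) \<Rightarrow> nat \<Rightarrow> 'a set" where
  "initial_ideal F r \<equiv> ideal_span (F ` {..<r})"

lemma initial_ideal_mono: "r \<le> m \<Longrightarrow> initial_ideal F r \<subseteq> initial_ideal F m"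
  by (intro ideal_span_mono) auto

lemma initial_ideal_base: "j < r \<Longrightarrow> F j \<in> initial_ideal F r"
  by (intro ideal_span_base) auto

text \<open>Expand a product of s + 1 elements of I_(r+1), each an element of I_r plus a multiple of
  \<open>F r\<close>: the term free of \<open>F r\<close> lies in I_r^(s+1), and the rest is
  \<open>F r\<close> times an element of I_(r+1)^s. The induction does this one factor at a
  time.\<close>

lemma ideal_power_initial_Suc:
  "ideal_power (initial_ideal F (Suc r)) (Suc s) =
     {a + F r * b |a b. a \<in> ideal_power (initial_ideal F r) (Suc s) \<and>
                        b \<in> ideal_power (initial_ideal F (Suc r)) s}" (is "?P = ?S s")
proof
  have sub: "initial_ideal F r \<subseteq> initial_ideal F (Suc r)" by (rule initial_ideal_mono) simp
  show S_subset: "?S s \<subseteq> ideal_power (initial_ideal F (Suc r)) (Suc s)" for s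
  proof clarify
    fix a b assume "a \<in> ideal_power (initial_ideal F r) (Suc s)"
      "b \<in> ideal_power (initial_ideal F (Suc r)) s"
    then show "a + F r * b \<in> ideal_power (initial_ideal F (Suc r)) (Suc s)"
      using ideal_power_mono[OF sub] initial_ideal_base[of r "Suc r" F]
      by (intro ideal_power_add ideal_power_mult) auto
  qed
  have memS: "x \<in> ?S s" if "a \<in> ideal_power (initial_ideal F r) (Suc s)"
    "b \<in> ideal_power (initial_ideal F (Suc r)) s" "x = a + F r * b" for a b x s
    using that by auto
  have S: "is_ideal (?S s)" for s
    unfolding module.subspace_def[OF module_times]
  proof (intro conjI allI ballI)
    have "0 = 0 + F r * (0::'a)" by simp
    then show "0 \<in> ?S s"
      using ideal_subspace_0[OF is_ideal_ideal_power] by blast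
  next
    fix x y assume "x \<in> ?S s" "y \<in> ?S s"
    then obtain a b a' b' where *: "x = a + F r * b" "a \<in> ideal_power (initial_ideal F r) (Suc s)"
      "b \<in> ideal_power (initial_ideal F (Suc r)) s" "y = a' + F r * b'"
      "a' \<in> ideal_power (initial_ideal F r) (Suc s)" "b' \<in> ideal_power (initial_ideal F (Suc r)) s"
      by auto
    then have "x + y = (a + a') + F r * (b + b')" by (simp add: algebra_simps)
    then show "x + y \<in> ?S s" using * ideal_power_add by blast
  next
    fix c x assume "x \<in> ?S s"
    then obtain a b where *: "x = a + F r * b" "a \<in> ideal_power (initial_ideal F r) (Suc s)"
      "b \<in> ideal_power (initial_ideal F (Suc r)) s" by auto
    then have "c * x = c * a + F r * (c * b)" by (simp add: algebra_simps)
    then show "c * x \<in> ?S s" using * ideal_power_scale by blast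
  qed
  have "a * b \<in> ?S s" if a: "a \<in> initial_ideal F (Suc r)"
    and b: "b \<in> ideal_power (initial_ideal F (Suc r)) s" for a b s
    using a b
  proof (induction s arbitrary: a b)
    case 0
    from 0 obtain k where k: "a - k * F r \<in> initial_ideal F r"
      by (auto simp: lessThan_Suc ideal_span_breakdown_eq)
    have "(a - k * F r) * b \<in> ideal_power (initial_ideal F r) (Suc 0)"
      by (rule ideal_power_mult[OF k]) simp
    moreover have "a * b = (a - k * F r) * b + F r * (k * b)" by (simp add: algebra_simps)
    ultimately show ?case by (intro memS[of _ _ "k * b"]) auto
  next
    case (Suc s)
    from Suc.prems obtain k where k: "a - k * F r \<in> initial_ideal F r"
      by (auto simp: lessThan_Suc ideal_span_breakdown_eq)
    \<comment> \<open>The induction hypothesis yields the decomposition for the exponent of b, so b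
      itself can be split.\<close>
    have "?S s = ideal_power (initial_ideal F (Suc r)) (Suc s)"
    proof
      show "ideal_power (initial_ideal F (Suc r)) (Suc s) \<subseteq> ?S s"
        by (rule ideal_power_Suc_subset[OF S Suc.IH])
    qed (rule S_subset)
    with Suc.prems(2) have "b \<in> ?S s" by blast
    then obtain p q where b: "b = p + F r * q"
      "p \<in> ideal_power (initial_ideal F r) (Suc s)" "q \<in> ideal_power (initial_ideal F (Suc r)) s"
      by auto
    have "(a - k * F r) * p \<in> ideal_power (initial_ideal F r) (Suc (Suc s))"
      by (rule ideal_power_mult[OF k b(2)])
    moreover have "(a - k * F r) * q + k * b \<in> ideal_power (initial_ideal F (Suc r)) (Suc s)"
      using ideal_power_add[OF ideal_power_mult[OF subsetD[OF sub k] b(3)] ideal_power_scale[OF Suc.prems(2)]] .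
    moreover have "a * b = (a - k * F r) * p + F r * ((a - k * F r) * q + k * b)"
      by (simp add: b(1) algebra_simps)
    ultimately show ?case by (rule memS)
  qed
  then show "?P \<subseteq> ?S s" by (intro ideal_power_Suc_subset[OF S])
qed

lemma ideal_power_zero_ideal: "ideal_power (ideal_span {}) (Suc s) = {0}"
proof -
  have "ideal_power (ideal_span {}) (Suc s) \<subseteq> {0}"
    by (rule ideal_power_Suc_subset) (auto simp: module.subspace_single_0[OF module_times]
        module.span_empty[OF module_times])
  then show ?thesis using ideal_subspace_0[OF is_ideal_ideal_power] by blast
qed

lemma aug_image: "aug F r s ` free_module (words r s) = ideal_power (initial_ideal F r) s"
proof (induction r s rule: words.induct)
  case (1 r)
  have "p \<in> aug F r 0 ` free_module (words r 0)" for p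
    by (rule image_eqI[of _ _ "\<lambda>w. if w = [] then p else 0"]) (auto simp: free_module_def)
  then show ?case by auto
next
  case (2 s)
  show ?case by (auto simp: ideal_power_zero_ideal intro!: image_eqI free_module_zero)
next
  case (3 r s)
  show ?case
  proof (intro equalityI subsetI)
    fix p assume "p \<in> aug F (Suc r) (Suc s) ` free_module (words (Suc r) (Suc s))"
    then obtain u where u: "u \<in> free_module (words (Suc r) (Suc s))" "p = aug F (Suc r) (Suc s) u"
      by auto
    then show "p \<in> ideal_power (initial_ideal F (Suc r)) (Suc s)"
      unfolding ideal_power_initial_Suc 3[symmetric] by (auto simp: free_module_words_Suc)
  next
    fix p assume "p \<in> ideal_power (initial_ideal F (Suc r)) (Suc s)"
    then obtain x y where "x \<in> free_module (words r (Suc s))" "y \<in> free_module (words (Suc r) s)"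
      "p = aug F r (Suc s) x + F r * aug F (Suc r) s y"
      unfolding ideal_power_initial_Suc 3[symmetric] by auto
    then show "p \<in> aug F (Suc r) (Suc s) ` free_module (words (Suc r) (Suc s))"
      by (intro image_eqI[of _ _ "glue x y (\<lambda>_. 0)"]) (auto simp: free_module_words_Suc)
  qed
qed

text \<open>Discarding the coordinates of positive homological degree keeps the augmentation and
  turns any preimage into a cycle.\<close>

lemma aug_preimage:
  assumes "p \<in> ideal_power (initial_ideal F r) s"
  obtains c where "c \<in> free_module (words r s)" "diff F r s c = (\<lambda>_. 0)" "aug F r s c = p"
proof -
  from assms obtain u where "u \<in> free_module (words r s)" "aug F r s u = p"
    unfolding aug_image[symmetric] by auto
  then show ?thesis
    by (intro that[of "part 0 u"]) (simp_all add: part_in_free_module diff_part_0 aug_part_0)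
qed

text \<open>\<open>aug\<close> multiplies every coordinate that it reads by s of the forms, and a
  coordinate in the ideal supplies one more factor. The ideal belongs to a fixed m because the
  recursion lowers r.\<close>

lemma aug_in_ideal_power:
  assumes "\<And>w. u w \<in> initial_ideal F m" "r \<le> m"
  shows "aug F r s u \<in> ideal_power (initial_ideal F m) (Suc s)"
  using assms
proof (induction r s arbitrary: u rule: words.induct)
  case (1 r)
  then show ?case using ideal_power_mult[of "u []" "initial_ideal F m" 1 0] by simp
next
  case (2 s)
  then show ?case by (simp add: ideal_subspace_0[OF is_ideal_ideal_power])
next
  case (3 r s)
  then have "F r * aug F (Suc r) s (\<lambda>v. u (Mult # v)) \<in> ideal_power (initial_ideal F m) (Suc (Suc s))"
    by (intro ideal_power_mult initial_ideal_base) auto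
  then show ?case using 3 by (auto intro!: ideal_power_add)
qed

text \<open>All homological degrees at once: \<open>diff\<close> vanishes on elements of degree 0
  and \<open>aug\<close> on elements of positive degree, so this contains exactness at G_0 and at
  every later G_i.\<close>

definition exact_at :: "(nat \<Rightarrow> 'a::comm_ring_1) \<Rightarrow> nat \<Rightarrow> nat \<Rightarrow> bool" where
  "exact_at F r s \<longleftrightarrow> (\<forall>u\<in>free_module (words r s). diff F r s u = (\<lambda>_. 0) \<longrightarrow> aug F r s u = 0 \<longrightarrow>
     (\<exists>w\<in>free_module (words r s). diff F r s w = u))"

text \<open>With I = I_r, exactness and a differential that vanishes modulo I make I^s/I^(s+1) free
  over R/I on the words without \<open>Cone\<close>, so an element regular on R/I is regular on it.
  The proof carries this out on representatives.\<close>

lemma regular_mod_ideal_power: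
  assumes exact: "\<And>s. exact_at F r s"
    and g: "\<And>x. g * x \<in> initial_ideal F r \<Longrightarrow> x \<in> initial_ideal F r"
  shows "g * x \<in> ideal_power (initial_ideal F r) s \<Longrightarrow> x \<in> ideal_power (initial_ideal F r) s"
proof (induction s)
  case (Suc s)
  let ?I = "initial_ideal F r"
  have "x \<in> ideal_power ?I s"
    using Suc ideal_power_decreasing by blast
  then obtain c where c: "c \<in> free_module (words r s)" "diff F r s c = (\<lambda>_. 0)" "aug F r s c = x"
    by (rule aug_preimage)
  obtain b where b: "b \<in> free_module (words r (Suc s))" "diff F r (Suc s) b = (\<lambda>_. 0)"
    "aug F r (Suc s) b = g * x"
    using aug_preimage[OF Suc.prems] .
  \<comment> \<open>Both terms are cycles with augmentation \<open>g * x\<close>, so the difference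
    is a boundary. The second term has coordinates in I because it is a restriction.\<close>
  let ?u = "\<lambda>v. g * c v - restr F r s b v"
  have "?u \<in> free_module (words r s)"
    by (intro free_module_minus free_module_scale restr_in_free_module b c)
  moreover have "diff F r s ?u = (\<lambda>_. 0)"
    by (simp add: diff_minus diff_scale diff_restr b c)
  moreover have "aug F r s ?u = 0"
    by (simp add: aug_minus aug_scale aug_restr b c)
  ultimately obtain w where w: "diff F r s w = ?u"
    using exact[of s] unfolding exact_at_def by blast
  have "c v \<in> ?I" for v
  proof (rule g)
    have "diff F r s w v \<in> ?I"
      by (rule diff_in_ideal) (auto intro: initial_ideal_base ideal_subspace_span)
    moreover have "restr F r s b v \<in> ?I"
      by (rule restr_in_ideal) (auto intro: initial_ideal_base ideal_subspace_span)
    ultimately have "diff F r s w v + restr F r s b v \<in> ?I" by (rule ideal_span_add)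
    then show "g * c v \<in> ?I" by (simp add: w)
  qed
  then show ?case using aug_in_ideal_power[of c F r r s] c(3) by simp
qed simp

text \<open>For a kernel element \<open>(x, y, z)\<close>, the component \<open>z\<close> is a boundary. Regularity enters through
  \<open>aug x + F r * aug y = 0\<close>: it puts \<open>aug y\<close> into the power of the smaller ideal, so the preimage
  of \<open>- z\<close> can be chosen with augmentation \<open>- aug y\<close>, and then the corrected \<open>x\<close> and \<open>y\<close> are
  boundaries as well.\<close>

lemma exact_at_Suc:
  assumes exact: "\<And>s. exact_at F r s" and "exact_at F (Suc r) s"
    and g: "\<And>x. F r * x \<in> initial_ideal F r \<Longrightarrow> x \<in> initial_ideal F r"
  shows "exact_at F (Suc r) (Suc s)"
  unfolding exact_at_def
proof (intro ballI impI)
  fix u assume u: "u \<in> free_module (words (Suc r) (Suc s))"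
    and du: "diff F (Suc r) (Suc s) u = (\<lambda>_. 0)" and au: "aug F (Suc r) (Suc s) u = 0"
  define x y z where "x = (\<lambda>v. u (Skip # v))" and "y = (\<lambda>v. u (Mult # v))" and "z = (\<lambda>v. u (Cone # v))"
  have mem: "u [] = 0" "x \<in> free_module (words r (Suc s))" "y \<in> free_module (words (Suc r) s)"
    "z \<in> free_module (words r (Suc s))"
    using u by (simp_all add: free_module_words_Suc x_def y_def z_def)
  have dx: "diff F r (Suc s) x v = - F r * z v" for v
    using fun_cong[OF du, of "Skip # v"] by (simp add: x_def z_def eq_neg_iff_add_eq_0)
  have dy: "diff F (Suc r) s y = incl s (restr F r s z)"
    using fun_cong[OF du, of "Mult # v" for v] by (auto simp: y_def z_def)
  have dz: "diff F r (Suc s) z = (\<lambda>_. 0)"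
    using fun_cong[OF du, of "Cone # v" for v] by (auto simp: z_def)
  \<comment> \<open>By \<open>dy\<close> the image of z under restriction and inclusion is a
    boundary, and both maps preserve augmentations.\<close>
  have "aug F r (Suc s) z = 0"
    using aug_diff[of F "Suc r" s y] by (simp add: dy aug_incl aug_restr)
  then obtain c where c: "c \<in> free_module (words r (Suc s))" "diff F r (Suc s) c = z"
    using exact[of "Suc s"] dz mem unfolding exact_at_def by blast
  have "F r * aug F (Suc r) s y = aug F r (Suc s) (\<lambda>v. - 1 * x v)"
    unfolding aug_scale using au by (simp add: x_def y_def eq_neg_iff_add_eq_0 add.commute)
  also have "\<dots> \<in> ideal_power (initial_ideal F r) (Suc s)"
    using mem free_module_scale[of x _ "-1"] unfolding aug_image[symmetric] by blast
  finally have "aug F (Suc r) s y \<in> ideal_power (initial_ideal F r) (Suc s)"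
    using regular_mod_ideal_power[OF exact g] by blast
  moreover have "aug F r (Suc s) c \<in> ideal_power (initial_ideal F r) (Suc s)"
    using c unfolding aug_image[symmetric] by blast
  ultimately have "aug F r (Suc s) c - aug F (Suc r) s y \<in> ideal_power (initial_ideal F r) (Suc s)"
    by (intro ideal_subspace_diff[OF is_ideal_ideal_power])
  then obtain b where b: "b \<in> free_module (words r (Suc s))" "diff F r (Suc s) b = (\<lambda>_. 0)"
    "aug F r (Suc s) b = aug F r (Suc s) c - aug F (Suc r) s y"
    by (rule aug_preimage)
  \<comment> \<open>The cycle b corrects the augmentation of \<open>- c\<close> without changing its
    boundary \<open>- z\<close>.\<close>
  define k where "k = (\<lambda>v. b v - c v)"
  have k: "k \<in> free_module (words r (Suc s))" "diff F r (Suc s) k = (\<lambda>v. - z v)"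
    "aug F r (Suc s) k = - aug F (Suc r) s y"
    unfolding k_def using b c by (simp_all add: free_module_minus diff_minus aug_minus)
  \<comment> \<open>What is left of x and y after removing the contributions that k, placed in the
    \<open>Cone\<close> summand, makes to the \<open>Skip\<close> and \<open>Mult\<close>
    coordinates of \<open>diff\<close>.\<close>
  let ?x = "\<lambda>v. x v - F r * k v" and ?y = "\<lambda>v. y v + incl s (restr F r s k) v"
  have "?x \<in> free_module (words r (Suc s))" "diff F r (Suc s) ?x = (\<lambda>_. 0)" "aug F r (Suc s) ?x = 0"
    using mem k au dx
    by (simp_all add: free_module_minus free_module_scale diff_minus diff_scale aug_minus aug_scale
        x_def[symmetric] y_def[symmetric])
  then obtain x' where x': "x' \<in> free_module (words r (Suc s))" "diff F r (Suc s) x' = ?x"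
    using exact[of "Suc s"] unfolding exact_at_def by blast
  have "?y \<in> free_module (words (Suc r) s)" "diff F (Suc r) s ?y = (\<lambda>_. 0)" "aug F (Suc r) s ?y = 0"
    using mem k dy
    by (simp_all add: free_module_add incl_in_free_module restr_in_free_module diff_add aug_add
        diff_incl diff_restr aug_incl aug_restr restr_uminus incl_uminus)
  then obtain y' where y': "y' \<in> free_module (words (Suc r) s)" "diff F (Suc r) s y' = ?y"
    using assms(2) unfolding exact_at_def by blast
  show "\<exists>w\<in>free_module (words (Suc r) (Suc s)). diff F (Suc r) (Suc s) w = u"
  proof
    show "glue x' y' k \<in> free_module (words (Suc r) (Suc s))"
      using x' y' k by (simp add: free_module_words_Suc)
    show "diff F (Suc r) (Suc s) (glue x' y' k) = u"
      by (rule glue_ext) (simp_all add: x' y' k mem, simp_all add: x_def y_def z_def)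
  qed
qed

text \<open>For s = 0 the complex is one copy of R with the identity as augmentation; for r = 0 and
  s > 0 it is zero.\<close>

lemma exact_at_trivial:
  assumes "r = 0 \<or> s = 0"
  shows "exact_at F r s"
  unfolding exact_at_def
proof (intro ballI impI)
  fix u assume u: "u \<in> free_module (words r s)" and a: "aug F r s u = 0"
  have "u w = 0" for w
  proof (cases s)
    case 0
    then show ?thesis using u a by (cases "w = []") (simp_all add: free_module_def)
  next
    case (Suc s')
    then show ?thesis using u assms by (simp add: free_module_def)
  qed
  then have "u = (\<lambda>_. 0)" by blast
  then have "diff F r s u = u" by simp
  then show "\<exists>w\<in>free_module (words r s). diff F r s w = u" using u by blast
qed

text \<open>The outer induction on r provides exactness of G(r, s) for all s, as regularity modulo
  powers requires; the inner one on s provides the \<open>Mult\<close> summand.\<close>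

lemma exact_at_if_regular:
  assumes "\<And>j g. j < r \<Longrightarrow> F j * g \<in> initial_ideal F j \<Longrightarrow> g \<in> initial_ideal F j"
  shows "exact_at F r s"
  using assms
proof (induction r arbitrary: s)
  case (0 s)
  show ?case by (rule exact_at_trivial) simp
next
  case (Suc r s)
  have exact: "exact_at F r s" for s
    by (rule Suc.IH) (rule Suc.prems, simp_all)
  have reg: "F r * g \<in> initial_ideal F r \<Longrightarrow> g \<in> initial_ideal F r" for g
    by (rule Suc.prems) simp_all
  show ?case
  proof (induction s)
    case 0
    show ?case by (rule exact_at_trivial) simp
  next
    case (Suc s)
    show ?case by (rule exact_at_Suc[OF exact Suc reg])
  qed
qed


section \<open>The grading\<close>

text \<open>The exponent vector a attached to a basis element: \<open>Mult\<close> and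
  \<open>Cone\<close> each record one factor of the last form, whose index is \<open>r - 1\<close>.
  A nonempty word in \<open>words r s\<close> has r > 0, so the subtraction is exact there.\<close>

fun expo :: "nat \<Rightarrow> step list \<Rightarrow> nat \<Rightarrow> nat" where
  "expo r [] = (\<lambda>_. 0)"
| "expo r (Skip # w) = expo (r - 1) w"
| "expo r (Mult # w) = (expo r w)(r - 1 := Suc (expo r w (r - 1)))"
| "expo r (Cone # w) = (expo (r - 1) w)(r - 1 := Suc (expo (r - 1) w (r - 1)))"

lemma expo_beyond: "w \<in> words r s \<Longrightarrow> r \<le> j \<Longrightarrow> expo r w j = 0"
proof (induction r s arbitrary: w j rule: words.induct)
  case (3 r s)
  show ?case
  proof (cases w rule: word_cases)
    case (Skip v)
    then show ?thesis using "3.prems" "3.IH"(1)[of v j] by simp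
  next
    case (Mult v)
    then show ?thesis using "3.prems" "3.IH"(2)[of v j] by simp
  next
    case (Cone v)
    then show ?thesis using "3.prems" "3.IH"(3)[of v j] by simp
  qed simp
qed simp_all

text \<open>The range n is kept apart from r, so that the sum keeps its length while the recursion
  lowers r.\<close>

definition weight :: "nat \<Rightarrow> (nat \<Rightarrow> nat) \<Rightarrow> nat \<Rightarrow> step list \<Rightarrow> int" where
  "weight n \<delta> r w = int (\<Sum>j<n. expo r w j * \<delta> j)"

lemma weight_fun_upd_Suc:
  "i < n \<Longrightarrow> (\<Sum>j<n. (a(i := Suc (a i))) j * \<delta> j) = \<delta> i + (\<Sum>j<n. a j * \<delta> j)"
  for a \<delta> :: "nat \<Rightarrow> nat"
  by (simp add: sum.remove[of "{..<n}" i] algebra_simps)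

lemma weight_simps:
  "weight n \<delta> (Suc r) (Skip # v) = weight n \<delta> r v"
  "r < n \<Longrightarrow> weight n \<delta> (Suc r) (Mult # v) = int (\<delta> r) + weight n \<delta> (Suc r) v"
  "r < n \<Longrightarrow> weight n \<delta> (Suc r) (Cone # v) = int (\<delta> r) + weight n \<delta> r v"
  using weight_fun_upd_Suc[of r n "expo (Suc r) v" \<delta>] weight_fun_upd_Suc[of r n "expo r v" \<delta>]
  by (simp_all add: weight_def del: fun_upd_apply)

section \<open>Arithmetic of forms\<close>

lemma forms_zero [simp]: "0 \<in> forms e"
  by (simp add: forms_def)

lemma forms_add: "p \<in> forms e \<Longrightarrow> q \<in> forms e \<Longrightarrow> p + q \<in> forms e"
  using Poly_Mapping.keys_add[of p q] by (auto simp: forms_def)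

lemma forms_uminus: "p \<in> forms e \<Longrightarrow> - p \<in> forms e"
  by (simp add: forms_def)

lemma forms_minus: "p \<in> forms e \<Longrightarrow> q \<in> forms e \<Longrightarrow> p - q \<in> forms e"
  using forms_add[of p e "- q"] forms_uminus[of q e] by simp

lemma monomial_degree_add: "monomial_degree (m + m') = monomial_degree m + monomial_degree m'"
  by (simp add: monomial_degree_def lookup_add sum.distrib)

lemma forms_mult: "p \<in> forms d \<Longrightarrow> q \<in> forms e \<Longrightarrow> p * q \<in> forms (d + e)"
  using keys_mult[of p q] by (fastforce simp: forms_def monomial_degree_add)

lemma free_[simp]: "(\<lambda>_. 0) \<in> free_component B deg e"
  by (simp add: free_component_def)

section \<open>Homogeneity of the maps for the polynomial grading\<close>

context
  fixes F :: "nat \<Rightarrow> ('v::finite, 'k::comm_ring_1) mpoly" and \<delta> :: "nat \<Rightarrow> nat" and n :: nat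
  assumes F: "\<And>j. j < n \<Longrightarrow> F j \<in> forms (int (\<delta> j))"
begin

abbreviation component :: "nat \<Rightarrow> nat \<Rightarrow> int \<Rightarrow> (step list \<Rightarrow> ('v, 'k) mpoly) set" where
  "component r s e \<equiv> free_component (words r s) (weight n \<delta> r) e"

lemma component_iff:
  "u \<in> component r s e \<longleftrightarrow> u \<in> free_module (words r s) \<and> (\<forall>w. u w \<in> forms (e - weight n \<delta> r w))"
  by (auto simp: free_component_def free_module_def)

text \<open>The graded decomposition of the cone: the \<open>Mult\<close> and \<open>Cone\<close>
  summands are shifted by the degree of \<open>F r\<close>, which makes multiplication by
  \<open>F r\<close> and restriction maps of degree 0.\<close>

lemma component_Suc:
  assumes "r < n"
  shows "u \<in> component (Suc r) (Suc s) e \<longleftrightarrow>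
     u [] = 0 \<and> (\<lambda>v. u (Skip # v)) \<in> component r (Suc s) e \<and>
     (\<lambda>v. u (Mult # v)) \<in> component (Suc r) s (e - int (\<delta> r)) \<and>
     (\<lambda>v. u (Cone # v)) \<in> component r (Suc s) (e - int (\<delta> r))" (is "?L \<longleftrightarrow> ?R")
proof
  assume ?L
  then show ?R
    unfolding component_iff free_module_words_Suc using weight_simps(1) weight_simps(2,3)[OF assms]
    by (metis (no_types, lifting) diff_diff_eq)
next
  assume R: ?R
  have "u w \<in> forms (e - weight n \<delta> (Suc r) w)" for w
    by (cases w rule: word_cases) (use R assms in \<open>simp_all add: component_iff weight_simps algebra_simps\<close>)
  with R show ?L
    by (simp add: component_iff free_module_words_Suc)
qed

lemma component_add: "u \<in> component r s e \<Longrightarrow> w \<in> component r s e \<Longrightarrow> (\<lambda>v. u v + w v) \<in> component r s e"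
  and component_minus: "u \<in> component r s e \<Longrightarrow> w \<in> component r s e \<Longrightarrow> (\<lambda>v. u v - w v) \<in> component r s e"
  and component_uminus: "u \<in> component r s e \<Longrightarrow> (\<lambda>v. - u v) \<in> component r s e"
  by (simp_all add: component_iff free_module_add free_module_minus free_module_uminus
      forms_add forms_minus forms_uminus)

lemma component_scale:
  "j < n \<Longrightarrow> u \<in> component r s (e - int (\<delta> j)) \<Longrightarrow> (\<lambda>v. F j * u v) \<in> component r s e"
  using forms_mult[OF F, of j "u w" "e - int (\<delta> j) - weight n \<delta> r w" for w]
  by (simp add: component_iff free_module_scale algebra_simps)

lemma incl_component:
  assumes "r < n" "u \<in> component r s e"
  shows "incl s u \<in> component (Suc r) s e"
proof (cases s)
  case 0
  then show ?thesis using assms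
    by (simp add: free_component_def weight_def)
next
  case (Suc s')
  then show ?thesis using assms by (simp add: component_Suc)
qed

lemma restr_component:
  "r \<le> n \<Longrightarrow> u \<in> component r (Suc s) e \<Longrightarrow> restr F r s u \<in> component r s e"
  by (induction r arbitrary: u)
    (simp_all add: component_Suc component_add component_scale incl_component)

lemma diff_component:
  "r \<le> n \<Longrightarrow> u \<in> component r s e \<Longrightarrow> diff F r s u \<in> component r s e"
  by (induction r s arbitrary: u e rule: words.induct)
    (simp_all add: component_Suc component_add component_minus component_uminus
      component_scale incl_component restr_component)

lemma aug_component:
  "r \<le> n \<Longrightarrow> u \<in> component r s e \<Longrightarrow> aug F r s u \<in> forms e"
proof (induction r s arbitrary: u e rule: words.induct)
  case (1 r)
  then have "u [] \<in> forms (e - weight n \<delta> r [])" unfolding component_iff by blast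
  then show ?case by (simp add: weight_def)
next
  case (3 r s)
  then have "F r * aug F (Suc r) s (\<lambda>v. u (Mult # v)) \<in> forms (int (\<delta> r) + (e - int (\<delta> r)))"
    by (intro forms_mult F) (auto simp: component_Suc)
  with 3 show ?case by (auto simp: component_Suc intro!: forms_add)
qed simp

end

section \<open>Forms and the irrelevant ideal\<close>

lemma single_in_irrelevant_ideal:
  assumes "monomial_degree m > 0"
  shows "Poly_Mapping.single m c \<in> irrelevant_ideal"
proof -
  obtain x where "Poly_Mapping.lookup m x > 0"
    using assms unfolding monomial_degree_def by (metis gr0I sum.neutral less_irrefl)
  then have "m = (m - Poly_Mapping.single x 1) + Poly_Mapping.single x 1"
    by (intro poly_mapping_eqI) (auto simp: lookup_add lookup_minus lookup_single when_def)
  then have "Poly_Mapping.single m c = Poly_Mapping.single (m - Poly_Mapping.single x 1) c * variable x"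
    by (metis mult_single mult.right_neutral variable_def)
  then show ?thesis
    unfolding irrelevant_ideal_def by (auto intro: ideal_span_scale ideal_span_base)
qed

lemma forms_in_irrelevant_ideal:
  assumes "p \<in> forms e" "e > 0"
  shows "p \<in> irrelevant_ideal"
proof -
  have "p = (\<Sum>m\<in>Poly_Mapping.keys p. Poly_Mapping.single m (Poly_Mapping.lookup p m))"
    by (rule poly_mapping_eqI)
      (auto simp: lookup_sum lookup_single when_def in_keys_iff)
  also have "\<dots> \<in> irrelevant_ideal"
    unfolding irrelevant_ideal_def
    by (rule module.span_sum[OF module_times])
      (use assms in \<open>auto simp: forms_def irrelevant_ideal_def[symmetric] intro!: single_in_irrelevant_ideal\<close>)
  finally show ?thesis .
qed

text \<open>Serves to exclude nonzero constants from a regular sequence, whose ideal is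
  proper.\<close>

lemma forms_0_unit:
  fixes p :: "('v::finite, 'k::field) mpoly"
  assumes "p \<in> forms 0" "p \<noteq> 0"
  obtains q where "q * p = 1"
proof -
  have keys: "Poly_Mapping.keys p \<subseteq> {0}"
  proof
    fix m assume "m \<in> Poly_Mapping.keys p"
    then have "monomial_degree m = 0" using assms by (simp add: forms_def)
    then show "m \<in> {0}" by (auto simp: monomial_degree_def intro!: poly_mapping_eqI)
  qed
  have p: "p = Poly_Mapping.single 0 (Poly_Mapping.lookup p 0)"
    by (rule poly_mapping_eqI) (use keys in \<open>auto simp: lookup_single when_def in_keys_iff\<close>)
  with assms have "Poly_Mapping.lookup p 0 \<noteq> 0" by auto
  then have "Poly_Mapping.single 0 (inverse (Poly_Mapping.lookup p 0)) * p = 1"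
    by (subst (2) p) (simp add: mult_single)
  then show ?thesis by (rule that)
qed


section \<open>Counting the summands\<close>

definition expo_fibre :: "nat \<Rightarrow> nat \<Rightarrow> nat \<Rightarrow> (nat \<Rightarrow> nat) \<Rightarrow> step list set" where
  "expo_fibre r s i a = {w \<in> words r s. cones w = i \<and> expo r w = a}"

lemma finite_expo_fibre: "finite (expo_fibre r s i a)"
  by (simp add: expo_fibre_def finite_words)

text \<open>\<open>Mult\<close> and \<open>Cone\<close> raise the entry at r, so a zero entry forces
  the first letter to be \<open>Skip\<close>.\<close>

lemma expo_fibre_Skip:
  assumes "a r = 0"
  shows "expo_fibre (Suc r) (Suc s) i a = (#) Skip ` expo_fibre r (Suc s) i a"
proof (rule set_eqI)
  fix w show "w \<in> expo_fibre (Suc r) (Suc s) i a \<longleftrightarrow> w \<in> (#) Skip ` expo_fibre r (Suc s) i a"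
    using assms by (cases w rule: word_cases) (auto simp: expo_fibre_def)
qed

text \<open>After \<open>Mult\<close> the entry at r may be raised again, whereas
  \<open>Cone\<close> leaves the index r for good. Hence \<open>Cone\<close> fits only an entry
  equal to 1, and it uses up one homological degree.\<close>

lemma expo_fibre_Mult_Cone:
  assumes "a r = Suc k"
  shows "expo_fibre (Suc r) (Suc s) i a = (#) Mult ` expo_fibre (Suc r) s i (a(r := k)) \<union>
    (#) Cone ` (if k = 0 \<and> i > 0 then expo_fibre r (Suc s) (i - 1) (a(r := k)) else {})"
    (is "?L = ?R")
proof (rule set_eqI)
  fix w show "w \<in> ?L \<longleftrightarrow> w \<in> ?R"
  proof (cases w rule: word_cases)
    case (Skip v)
    have "expo r v \<noteq> a" if "v \<in> words r (Suc s)"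
      using expo_beyond[OF that, of r] assms by auto
    then show ?thesis using Skip by (auto simp: expo_fibre_def)
  next
    case (Mult v)
    have "(expo (Suc r) v)(r := Suc (expo (Suc r) v r)) = a \<longleftrightarrow> expo (Suc r) v = a(r := k)"
      using assms by (auto simp: fun_eq_iff)
    then show ?thesis using Mult by (auto simp: expo_fibre_def)
  next
    case (Cone v)
    have "(expo r v)(r := Suc (expo r v r)) = a \<longleftrightarrow> k = 0 \<and> expo r v = a(r := k)"
      if "v \<in> words r (Suc s)"
      using expo_beyond[OF that, of r] assms by (auto simp: fun_eq_iff)
    then show ?thesis using Cone by (auto simp: expo_fibre_def)
  qed (auto simp: expo_fibre_def)
qed

lemma all_ge_iff_Suc: "(\<forall>j\<ge>r. P j) \<longleftrightarrow> P r \<and> (\<forall>j\<ge>Suc r. P j)" for r :: nat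
  by (metis Suc_leD le_refl not_less_eq_eq order_antisym_conv)

text \<open>With p nonzero entries, an entry 1 at r gives Pascal's rule: \<open>Mult\<close>
  contributes (p-2 choose i) and \<open>Cone\<close> contributes (p-2 choose i-1). Larger entries
  only allow \<open>Mult\<close> and keep p. If \<open>Mult\<close> exhausts s, the only
  continuation is the empty word, which is counted separately.\<close>

lemma card_expo_fibre:
  assumes "s > 0"
  shows "card (expo_fibre r s i a) =
    (if (\<forall>j\<ge>r. a j = 0) \<and> sum a {..<r} = s + i then (card {j. a j \<noteq> 0} - 1) choose i else 0)"
  using assms
proof (induction r s arbitrary: i a rule: words.induct)
  case (1 r)
  then show ?case by simp
next
  case (2 s)
  then show ?case by (simp add: expo_fibre_def)
next
  case (3 r s)
  show ?case
  proof (cases "a r")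
    case 0
    then have "(\<forall>j\<ge>Suc r. a j = 0) \<longleftrightarrow> (\<forall>j\<ge>r. a j = 0)"
      using all_ge_iff_Suc[of r "\<lambda>j. a j = 0"] by blast
    then show ?thesis
      using 0 "3.IH"(1)[of i a] by (simp add: expo_fibre_Skip[where a = a and r = r, OF 0] card_image)
  next
    case (Suc k)
    define b where "b = a(r := k)"
    let ?p = "card {j. a j \<noteq> 0}" and ?q = "card {j. b j \<noteq> 0}"
    have "card (expo_fibre (Suc r) (Suc s) i a) =
      card ((#) Mult ` expo_fibre (Suc r) s i b) +
      card ((#) Cone ` (if k = 0 \<and> i > 0 then expo_fibre r (Suc s) (i - 1) b else {}))"
      unfolding expo_fibre_Mult_Cone[where a = a and r = r, OF Suc] b_def
      by (rule card_Un_disjoint) (auto simp: finite_expo_fibre)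
    then have card: "card (expo_fibre (Suc r) (Suc s) i a) = card (expo_fibre (Suc r) s i b) +
      (if k = 0 \<and> i > 0 then card (expo_fibre r (Suc s) (i - 1) b) else 0)"
      by (simp add: card_image)
    have beyond: "(\<forall>j\<ge>Suc r. b j = 0) \<longleftrightarrow> (\<forall>j\<ge>Suc r. a j = 0)"
      by (auto simp: b_def)
    have beyond': "k = 0 \<Longrightarrow> (\<forall>j\<ge>r. b j = 0) \<longleftrightarrow> (\<forall>j\<ge>Suc r. a j = 0)"
      unfolding all_ge_iff_Suc[of r] by (simp add: b_def)
    have sum_b: "sum b {..<r} = sum a {..<r}" by (simp add: b_def)
    have "b r = k" by (simp add: b_def)
    show ?thesis
    proof (cases "\<forall>j\<ge>Suc r. a j = 0")
      case False
      have "card (expo_fibre (Suc r) s i b) = 0"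
      proof (cases s)
        case 0
        have "b \<noteq> (\<lambda>_. 0)" using False beyond by auto
        then show ?thesis using 0 by (auto simp: expo_fibre_def)
      next
        case (Suc s')
        then show ?thesis using "3.IH"(2)[of i b] False beyond by simp
      qed
      then show ?thesis
        using False card "3.IH"(1)[of "i - 1" b] beyond' by auto
    next
      case True
      have supp_a: "{j. a j \<noteq> 0} \<subseteq> {..<Suc r}"
        using True not_less by blast
      have supp_b: "{j. b j \<noteq> 0} \<subseteq> {..<Suc r}"
        using supp_a by (auto simp: b_def)
      have fin: "finite {j. a j \<noteq> 0}" "finite {j. b j \<noteq> 0}"
        by (rule finite_subset[OF supp_a], simp, rule finite_subset[OF supp_b], simp)
      have supp: "{j. a j \<noteq> 0} = insert r {j. b j \<noteq> 0}"
        using Suc by (auto simp: b_def)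
      have pq: "?p = (if k = 0 then Suc ?q else ?q)"
        using fin \<open>b r = k\<close> unfolding supp by (auto simp: insert_absorb)
      have q_le: "?q \<le> sum b {..<Suc r}"
      proof -
        have "?q = (\<Sum>j\<in>{j. b j \<noteq> 0}. 1)" by simp
        also have "\<dots> \<le> (\<Sum>j\<in>{j. b j \<noteq> 0}. b j)" by (rule sum_mono) auto
        also have "\<dots> = sum b {..<Suc r}"
          by (rule sum.mono_neutral_left) (use supp_b in auto)
        finally show ?thesis .
      qed
      have sum_ab: "sum a {..<Suc r} = Suc (sum b {..<Suc r})"
        using Suc by (simp add: sum_b \<open>b r = k\<close>)
      have q_pos: "?q > 0" if "sum b {..<Suc r} > 0"
      proof -
        from that have "\<not> (\<forall>j\<in>{..<Suc r}. b j = 0)"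
          by (metis less_irrefl sum.neutral)
        then have "{j. b j \<noteq> 0} \<noteq> {}" by blast
        then show ?thesis using fin(2) by (simp only: card_gt_0_iff simp_thms not_False_eq_True)
      qed
      let ?m = "sum b {..<Suc r}"
      have cone: "card (expo_fibre r (Suc s) (i - 1) b) =
          (if ?m = Suc s + (i - 1) then (?q - 1) choose (i - 1) else 0)" if "k = 0"
        using "3.IH"(1)[of "i - 1" b] beyond'[OF that] True \<open>b r = k\<close> that by simp
      have goal: ?thesis if "card (expo_fibre (Suc r) (Suc s) i a) = (if ?m = s + i then (?p - 1) choose i else 0)"
        using that True sum_ab by simp
      show ?thesis
      proof (cases s)
        case 0
        have "b = (\<lambda>_. 0) \<longleftrightarrow> ?m = 0"
        proof
          assume "?m = 0"
          then have "b j = 0" for j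
            using True beyond by (cases "j < Suc r") (auto simp: not_less less_Suc_eq)
          then show "b = (\<lambda>_. 0)" by blast
        qed simp
        then have "expo_fibre (Suc r) s i b = (if i = 0 \<and> ?m = 0 then {[]} else {})"
          using 0 by (auto simp: expo_fibre_def)
        then have fibre: "card (expo_fibre (Suc r) s i b) = (if i = 0 \<and> ?m = 0 then 1 else 0)"
          by simp
        show ?thesis
        proof (rule goal, cases i)
          case 0
          then show "card (expo_fibre (Suc r) (Suc s) i a) = (if ?m = s + i then (?p - 1) choose i else 0)"
            using \<open>s = 0\<close> unfolding card fibre by simp
        next
          case (Suc i')
          \<comment> \<open>Here b has sum i, so it has at most i nonzero entries; the
            \<open>Mult\<close> term of Pascal's rule therefore vanishes, in accordance with the
            empty fibre.\<close>
          have "(?q - 1) choose i' = ?q choose i" "(?q - 1) choose i = 0" if "?m = i"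
            using q_pos q_le that Suc by (cases "?q = i"; simp add: binomial_eq_0)+
          then show "card (expo_fibre (Suc r) (Suc s) i a) = (if ?m = s + i then (?p - 1) choose i else 0)"
            using \<open>s = 0\<close> Suc cone pq unfolding card fibre by (simp del: sum.lessThan_Suc)
        qed
      next
        case (Suc s')
        then have fibre: "card (expo_fibre (Suc r) s i b) = (if ?m = s + i then (?q - 1) choose i else 0)"
          using "3.IH"(2)[of i b] True beyond by (simp del: sum.lessThan_Suc)
        show ?thesis
        proof (rule goal, cases i)
          case 0
          then show "card (expo_fibre (Suc r) (Suc s) i a) = (if ?m = s + i then (?p - 1) choose i else 0)"
            unfolding card fibre by (simp del: sum.lessThan_Suc)
        next
          case (Suc i')
          \<comment> \<open>Pascal's rule; the sum of b is positive, so \<open>?q - 1\<close> is a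
            true predecessor.\<close>
          have "?q choose i = ((?q - 1) choose i) + ((?q - 1) choose i')" if "?m = s + i"
            using q_pos that Suc by (cases ?q) (simp_all del: sum.lessThan_Suc)
          then show "card (expo_fibre (Suc r) (Suc s) i a) = (if ?m = s + i then (?p - 1) choose i else 0)"
            using Suc cone pq unfolding card fibre by (simp del: sum.lessThan_Suc)
        qed
      qed
    qed
  qed
qed

section \<open>Counting the sequences of the iterated direct sum\<close>

lemma card_sorted_lists:
  assumes "finite A"
  shows "card {l :: nat list. length l = i \<and> sorted l \<and> set l \<subseteq> A} = (card A + i - 1) choose i"
proof -
  have "bij_betw mset {l. length l = i \<and> sorted l \<and> set l \<subseteq> A} (multisets_of_size A i)"
    by (rule bij_betw_byWitness[where f' = sorted_list_of_multiset])
      (auto simp: multisets_of_size_def sorted_sort_id, metis mset_sorted_list_of_multiset size_mset)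
  then show ?thesis using card_multisets_of_size[OF assms] by (simp add: bij_betw_same_card)
qed

lemma sorted_le_last: "sorted l \<Longrightarrow> x \<in> set l \<Longrightarrow> x \<le> last l"
  by (induction l) auto

text \<open>Turns the condition that the last entry is at most the number p of nonzero exponents
  into a smaller interval for all entries.\<close>

lemma sorted_subset_iff:
  fixes l :: "nat list"
  assumes "sorted l" "l \<noteq> []" "p \<le> r"
  shows "set l \<subseteq> {m..r} \<and> last l \<le> p \<longleftrightarrow> set l \<subseteq> {m..p}"
proof
  assume *: "set l \<subseteq> {m..r} \<and> last l \<le> p"
  show "set l \<subseteq> {m..p}"
  proof
    fix x assume x: "x \<in> set l"
    then have "x \<le> p" using sorted_le_last[OF assms(1) x] * by linarith
    then show "x \<in> {m..p}" using * x by auto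
  qed
next
  assume *: "set l \<subseteq> {m..p}"
  moreover have "last l \<in> set l" using assms by simp
  moreover have "{m..p} \<subseteq> {m..r}" using assms by simp
  ultimately show "set l \<subseteq> {m..r} \<and> last l \<le> p" by (meson atLeastAtMost_iff subset_iff)
qed

text \<open>For fixed a with p nonzero entries, the sequences l are the multisets of size i in an
  interval of p - i elements, which number (p-1 choose i).\<close>

lemma card_H_index_fibre:
  assumes "s > 0"
  shows "card {x \<in> H_index r s i. snd x = a} =
    (if length a = r \<and> sum_list a = s + i then (card {j. j < r \<and> a ! j \<noteq> 0} - 1) choose i else 0)"
proof (cases "length a = r \<and> sum_list a = s + i")
  case True
  let ?p = "card {j. j < r \<and> a ! j \<noteq> 0}"
  have "?p > 0"
  proof -
    obtain x where "x \<in> set a" "x \<noteq> 0"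
      using True assms by (metis add_is_0 less_numeral_extra(3) sum_list_eq_0_iff)
    then show ?thesis using True by (auto simp: card_gt_0_iff in_set_conv_nth)
  qed
  have "?p \<le> r" using card_mono[of "{..<r}" "{j. j < r \<and> a ! j \<noteq> 0}"] by auto
  \<comment> \<open>For i = 0 the sequence is empty and the bound 1 replaces its last entry; it
    holds because s > 0 forces a nonzero exponent.\<close>
  have last: "set l \<subseteq> {i + 1..r} \<and> (if i = 0 then 1 else last l) \<le> ?p \<longleftrightarrow> set l \<subseteq> {i + 1..?p}"
    if "length l = i" "sorted l" for l
  proof (cases "i = 0")
    case True
    then show ?thesis using that \<open>?p > 0\<close> by auto
  next
    case False
    then show ?thesis using sorted_subset_iff[OF that(2) _ \<open>?p \<le> r\<close>] that(1) by auto
  qed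
  have "(l, a) \<in> H_index r s i \<longleftrightarrow> length l = i \<and> sorted l \<and> set l \<subseteq> {i + 1..?p}" for l
    using True last[of l] unfolding H_index_def M_set_def mem_Collect_eq prod.case by blast
  then have "{x \<in> H_index r s i. snd x = a} =
    (\<lambda>l. (l, a)) ` {l. length l = i \<and> sorted l \<and> set l \<subseteq> {i + 1..?p}}"
    by force
  then have "card {x \<in> H_index r s i. snd x = a} = (card {i + 1..?p} + i - 1) choose i"
    by (simp add: card_image inj_on_def card_sorted_lists)
  \<comment> \<open>For i > p the interval is empty and both binomial coefficients are 0.\<close>
  also have "\<dots> = (?p - 1) choose i"
    using \<open>?p > 0\<close> by (cases "i \<le> ?p") (auto simp: binomial_eq_0)
  finally show ?thesis using True by simp
next
  case False
  then have "{x \<in> H_index r s i. snd x = a} = {}" by (auto simp: H_index_def M_set_def)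
  then show ?thesis using False by (simp only: card.empty if_False)
qed

lemma finite_H_index: "finite (H_index r s i)"
proof (rule finite_subset)
  show "H_index r s i \<subseteq> {l. set l \<subseteq> {i + 1..r} \<and> length l = i} \<times> {a. set a \<subseteq> {..s + i} \<and> length a = r}"
  proof
    fix x assume "x \<in> H_index r s i"
    moreover from this have "\<forall>y\<in>set (snd x). y \<le> s + i"
      using member_le_sum_list[of _ "snd x"] by (auto simp: H_index_def M_set_def)
    ultimately show "x \<in> {l. set l \<subseteq> {i + 1..r} \<and> length l = i} \<times> {a. set a \<subseteq> {..s + i} \<and> length a = r}"
      by (auto simp: H_index_def M_set_def)
  qed
qed (auto intro: finite_lists_length_eq)

section \<open>Matching words with the summands\<close>

definition expo_list :: "nat \<Rightarrow> step list \<Rightarrow> nat list" where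
  "expo_list r w = map (expo r w) [0..<r]"

lemma card_expo_list_fibre:
  assumes "s > 0"
  shows "card {w \<in> words r s. cones w = i \<and> expo_list r w = a} =
    (if length a = r \<and> sum_list a = s + i then (card {j. j < r \<and> a ! j \<noteq> 0} - 1) choose i else 0)"
proof (cases "length a = r")
  case True
  \<comment> \<open>Extension by zero is the right choice because exponents of words in
    \<open>words r s\<close> vanish from r on.\<close>
  define b where "b = (\<lambda>j. if j < r then a ! j else 0)"
  have "expo_list r w = a \<longleftrightarrow> expo r w = b" if "w \<in> words r s" for w
  proof -
    have "expo_list r w = a \<longleftrightarrow> (\<forall>j<r. expo r w j = a ! j)"
      using True by (auto simp: expo_list_def list_eq_iff_nth_eq)
    also have "\<dots> \<longleftrightarrow> expo r w = b"
    proof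
      assume *: "\<forall>j<r. expo r w j = a ! j"
      show "expo r w = b"
      proof
        fix j show "expo r w j = b j"
          using * expo_beyond[OF that, of j] by (cases "j < r") (simp_all add: b_def)
      qed
    qed (simp add: b_def)
    finally show ?thesis .
  qed
  then have "{w \<in> words r s. cones w = i \<and> expo_list r w = a} = expo_fibre r s i b"
    by (auto simp: expo_fibre_def)
  moreover have "sum b {..<r} = sum_list a"
    using True by (simp add: b_def sum_list_sum_nth atLeast0LessThan)
  moreover have "{j. b j \<noteq> 0} = {j. j < r \<and> a ! j \<noteq> 0}" by (auto simp: b_def)
  moreover have "\<forall>j\<ge>r. b j = 0" by (simp add: b_def)
  ultimately show ?thesis using card_expo_fibre[OF assms, of r i b] True by simp
next
  case False
  then have "{w \<in> words r s. cones w = i \<and> expo_list r w = a} = {}" by (auto simp: expo_list_def)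
  then show ?thesis using False by (simp only: card.empty if_False simp_thms)
qed

text \<open>Equal counts over each exponent vector yield a bijection that preserves degrees, by
  choosing one on every fibre and combining the choices.\<close>

lemma bij_betw_of_card_fibres:
  assumes "finite A" "finite B" and card: "\<And>c. card {x \<in> A. f x = c} = card {y \<in> B. g y = c}"
  obtains h where "bij_betw h A B" "\<And>x. x \<in> A \<Longrightarrow> g (h x) = f x"
proof -
  have "\<exists>h. bij_betw h {x \<in> A. f x = c} {y \<in> B. g y = c}" for c
    by (rule finite_same_card_bij) (use assms in auto)
  then obtain H where H: "\<And>c. bij_betw (H c) {x \<in> A. f x = c} {y \<in> B. g y = c}" by metis
  define h where "h x = H (f x) x" for x
  have "H (f x) x \<in> {y \<in> B. g y = f x}" if "x \<in> A" for x
    by (rule bij_betw_apply[OF H]) (simp add: that)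
  then have h: "h x \<in> B" "g (h x) = f x" if "x \<in> A" for x
    using that unfolding h_def by blast+
  have "inj_on h A"
  proof (rule inj_onI)
    fix x y assume xy: "x \<in> A" "y \<in> A" "h x = h y"
    have "f x = f y" using h(2)[OF xy(1)] h(2)[OF xy(2)] xy(3) by simp
    with xy show "x = y"
      by (intro inj_onD[OF bij_betw_imp_inj_on[OF H[of "f x"]]]) (simp_all add: h_def)
  qed
  moreover have "h ` A = B"
  proof
    show "B \<subseteq> h ` A"
    proof
      fix y assume "y \<in> B"
      then have "y \<in> H (g y) ` {x \<in> A. f x = g y}"
        unfolding bij_betw_imp_surj_on[OF H] by simp
      then obtain x where "x \<in> A" "f x = g y" "y = H (g y) x" by blast
      then show "y \<in> h ` A" by (intro image_eqI[of _ _ x]) (simp_all add: h_def)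
    qed
  qed (use h(1) in blast)
  ultimately show ?thesis using h(2) by (intro that[of h] bij_betw_imageI)
qed

section \<open>The resolution\<close>

lemma graded_homI:
  assumes "\<And>u. u \<in> M \<Longrightarrow> f u \<in> N"
    and "\<And>u w. u \<in> M \<Longrightarrow> w \<in> M \<Longrightarrow> f (u + w) = f u + f w"
    and "\<And>c u. u \<in> M \<Longrightarrow> f (scM c u) = scN c (f u)"
    and "\<And>e u. u \<in> grM e \<Longrightarrow> f u \<in> grN e"
  shows "graded_hom scM M grM scN N grN f"
  unfolding graded_hom_def using assms by (simp add: Pi_iff image_subset_iff)

section \<open>Transport of a resolution along bijections of the bases\<close>

lemma minimal_graded_free_resolution_reindex:
  fixes B :: "nat \<Rightarrow> 'b set" and C :: "nat \<Rightarrow> 'c set"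
    and \<epsilon> :: "('c \<Rightarrow> ('v::finite, 'k::field) mpoly) \<Rightarrow> ('v, 'k) mpoly"
  assumes bij: "\<And>i. bij_betw (h i) (B i) (C i)"
    and deg: "\<And>i b. b \<in> B i \<Longrightarrow> deg i b = deg' i (h i b)"
    and res: "minimal_graded_free_resolution N C deg' \<phi> \<epsilon> J"
  shows "\<exists>\<phi>' \<epsilon>'. minimal_graded_free_resolution N B deg \<phi>' \<epsilon>' J"
proof -
  define g where "g i = inv_into (B i) (h i)" for i
  \<comment> \<open>\<open>T\<close> and \<open>S\<close> become mutually inverse graded
    isomorphisms of the free modules; cutting off outside the index sets makes their values lie in
    these modules for every argument.\<close>
  define T where "T i u = (\<lambda>c. if c \<in> C i then u (g i c) else 0)" for i and u :: "'b \<Rightarrow> ('v, 'k) mpoly"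
  define S where "S i v = (\<lambda>b. if b \<in> B i then v (h i b) else 0)" for i and v :: "'c \<Rightarrow> ('v, 'k) mpoly"
  have h: "h i b \<in> C i" if "b \<in> B i" for i b using bij_betwE[OF bij] that by blast
  have g: "g i c \<in> B i" if "c \<in> C i" for i c
    unfolding g_def using bij_betwE[OF bij_betw_inv_into[OF bij]] that by blast
  have hg: "h i (g i c) = c" if "c \<in> C i" for i c
    unfolding g_def using bij_betw_inv_into_right[OF bij that] .
  have gh: "g i (h i b) = b" if "b \<in> B i" for i b
    unfolding g_def using bij_betw_inv_into_left[OF bij that] .
  have TS: "T i (S i v) = v" if "v \<in> free_module (C i)" for i v
  proof
    fix c show "T i (S i v) c = v c"
      using that g[of c i] hg[of c i] by (cases "c \<in> C i") (simp_all add: T_def S_def free_module_def)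
  qed
  have ST: "S i (T i u) = u" if "u \<in> free_module (B i)" for i u
  proof
    fix b show "S i (T i u) b = u b"
      using that h[of b i] gh[of b i] by (cases "b \<in> B i") (simp_all add: T_def S_def free_module_def)
  qed
  have T_in: "T i u \<in> free_module (C i)" and S_in: "S i v \<in> free_module (B i)" for i u v
    by (auto simp: T_def S_def free_module_def)
  have T_add: "T i (u + w) = T i u + T i w" and T_scale: "T i (free_scale c u) = free_scale c (T i u)" for i u w c
    by (auto simp: T_def free_scale_def)
  have S_add: "S i (u + w) = S i u + S i w" and S_scale: "S i (free_scale c u) = free_scale c (S i u)" for i u w c
    by (auto simp: S_def free_scale_def)
  have T_0: "T i 0 = 0" and S_0: "S i 0 = 0" for i by (auto simp: T_def S_def)
  have T_comp: "T i u \<in> free_component (C i) (deg' i) e" if "u \<in> free_component (B i) (deg i) e" for i u e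
  proof -
    have "u (g i c) \<in> forms (e - deg' i c)" if "c \<in> C i" for c
      using \<open>u \<in> free_component (B i) (deg i) e\<close> g[OF that] deg[OF g[OF that]] hg[OF that]
      unfolding free_component_def by (metis (mono_tags, lifting) mem_Collect_eq)
    then show ?thesis using T_in by (simp add: free_component_def T_def)
  qed
  have S_comp: "S i v \<in> free_component (B i) (deg i) e" if "v \<in> free_component (C i) (deg' i) e" for i v e
    using that h S_in by (simp add: free_component_def S_def deg)
  have T_image: "T i ` free_module (B i) = free_module (C i)" for i
  proof
    show "free_module (C i) \<subseteq> T i ` free_module (B i)"
    proof
      fix v :: "'c \<Rightarrow> ('v, 'k) mpoly" assume "v \<in> free_module (C i)"
      then have "v = T i (S i v)" using TS by simp
      then show "v \<in> T i ` free_module (B i)" using S_in by (rule image_eqI)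
    qed
  qed (use T_in in blast)
  define \<phi>' where "\<phi>' i u = S (i - 1) (\<phi> i (T i u))" for i u
  define \<epsilon>' where "\<epsilon>' u = \<epsilon> (T 0 u)" for u
  have finite_C: "\<forall>i. finite (C i)" and C_empty: "\<forall>i>N. C i = {}"
    and hom: "\<forall>i. graded_hom
      free_scale (free_module (C (Suc i))) (free_component (C (Suc i)) (deg' (Suc i)))
      free_scale (free_module (C i)) (free_component (C i) (deg' i)) (\<phi> (Suc i))"
    and aug: "graded_hom free_scale (free_module (C 0)) (free_component (C 0) (deg' 0))
      (*) J (\<lambda>e. J \<inter> forms e) \<epsilon>"
    and surj: "\<epsilon> ` free_module (C 0) = J"
    and exact_0: "{u \<in> free_module (C 0). \<epsilon> u = 0} = \<phi> 1 ` free_module (C 1)"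
    and exact: "\<forall>i\<ge>1. {u \<in> free_module (C i). \<phi> i u = 0} = \<phi> (Suc i) ` free_module (C (Suc i))"
    and minimal: "\<forall>i. \<forall>u\<in>free_module (C (Suc i)). \<forall>b. \<phi> (Suc i) u b \<in> irrelevant_ideal"
    using res unfolding minimal_graded_free_resolution_def by - (elim conjE, assumption)+
  note hom = hom[rule_format, unfolded graded_hom_def] and aug = aug[unfolded graded_hom_def]
  have \<phi>_in: "\<phi> (Suc i) u \<in> free_module (C i)" if "u \<in> free_module (C (Suc i))" for i u
    using hom[of i] that by (simp add: Pi_iff)
  \<comment> \<open>A general P covers both exactness at G_0, where the kernel is that of the
    augmentation, and exactness in positive degrees.\<close>
  have kernel_image: "{u \<in> free_module (B i). P (T i u)} = \<phi>' (Suc i) ` free_module (B (Suc i))"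
    if "{u \<in> free_module (C i). P u} = \<phi> (Suc i) ` free_module (C (Suc i))" for i P
  proof (intro equalityI subsetI)
    fix u assume u: "u \<in> {u \<in> free_module (B i). P (T i u)}"
    then have "T i u \<in> \<phi> (Suc i) ` free_module (C (Suc i))" using that T_in by blast
    then obtain w where w: "w \<in> free_module (B (Suc i))" "T i u = \<phi> (Suc i) (T (Suc i) w)"
      unfolding T_image[symmetric] by blast
    have "u = S i (T i u)" using ST u by simp
    also have "\<dots> = \<phi>' (Suc i) w" unfolding w(2) by (simp add: \<phi>'_def)
    finally have "u = \<phi>' (Suc i) w" .
    with w show "u \<in> \<phi>' (Suc i) ` free_module (B (Suc i))" by blast
  next
    fix u assume "u \<in> \<phi>' (Suc i) ` free_module (B (Suc i))"
    then obtain w where "u = \<phi>' (Suc i) w" by blast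
    then have w: "u = S i (\<phi> (Suc i) (T (Suc i) w))" by (simp add: \<phi>'_def)
    then have "T i u = \<phi> (Suc i) (T (Suc i) w)" using TS[OF \<phi>_in[OF T_in]] by simp
    then have "T i u \<in> \<phi> (Suc i) ` free_module (C (Suc i))" using T_in by blast
    then have "P (T i u)" unfolding that[symmetric] by simp
    then show "u \<in> {u \<in> free_module (B i). P (T i u)}" using w S_in by simp
  qed
  have "minimal_graded_free_resolution N B deg \<phi>' \<epsilon>' J"
    unfolding minimal_graded_free_resolution_def
  proof (intro conjI allI impI ballI)
    show "finite (B i)" for i
      using finite_C bij_betw_finite[OF bij[of i]] by simp
    show "B i = {}" if "i > N" for i
    proof -
      have "C i = {}" using C_empty that by simp
      then show ?thesis using h by blast
    qed
    show "graded_hom free_scale (free_module (B (Suc i))) (free_component (B (Suc i)) (deg (Suc i)))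
      free_scale (free_module (B i)) (free_component (B i) (deg i)) (\<phi>' (Suc i))" for i
    proof (rule graded_homI)
      fix u w c
      show "\<phi>' (Suc i) u \<in> free_module (B i)" using S_in by (simp add: \<phi>'_def)
      show "\<phi>' (Suc i) (u + w) = \<phi>' (Suc i) u + \<phi>' (Suc i) w"
        using hom[of i] T_in[of "Suc i"]
        by (simp add: \<phi>'_def T_add S_add)
      show "\<phi>' (Suc i) (free_scale c u) = free_scale c (\<phi>' (Suc i) u)"
        using hom[of i] T_in[of "Suc i"]
        by (simp add: \<phi>'_def T_scale S_scale)
    next
      fix e and u :: "'b \<Rightarrow> ('v, 'k) mpoly" assume "u \<in> free_component (B (Suc i)) (deg (Suc i)) e"
      then have "\<phi> (Suc i) (T (Suc i) u) \<in> free_component (C i) (deg' i) e"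
        using hom[of i] T_comp by (simp add: image_subset_iff)
      then show "\<phi>' (Suc i) u \<in> free_component (B i) (deg i) e"
        using S_comp by (simp add: \<phi>'_def)
    qed
    show "graded_hom free_scale (free_module (B 0)) (free_component (B 0) (deg 0))
      (*) J (\<lambda>e. J \<inter> forms e) \<epsilon>'"
    proof (rule graded_homI)
      fix u w c
      show "\<epsilon>' u \<in> J" using aug T_in[of 0] by (simp add: \<epsilon>'_def Pi_iff)
      show "\<epsilon>' (u + w) = \<epsilon>' u + \<epsilon>' w" "\<epsilon>' (free_scale c u) = c * \<epsilon>' u"
        using aug T_in[of 0] by (simp_all add: \<epsilon>'_def T_add T_scale)
    next
      fix e and u :: "'b \<Rightarrow> ('v, 'k) mpoly" assume "u \<in> free_component (B 0) (deg 0) e"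
      then have "T 0 u \<in> free_component (C 0) (deg' 0) e" by (rule T_comp)
      moreover have "\<epsilon> ` free_component (C 0) (deg' 0) e \<subseteq> J \<inter> forms e" using aug by simp
      ultimately show "\<epsilon>' u \<in> J \<inter> forms e" unfolding \<epsilon>'_def by blast
    qed
    have "\<epsilon>' ` free_module (B 0) = \<epsilon> ` T 0 ` free_module (B 0)"
      by (simp add: \<epsilon>'_def image_image)
    also have "\<dots> = J"
      unfolding T_image by (rule surj)
    finally show "\<epsilon>' ` free_module (B 0) = J" .
    have "{u \<in> free_module (C 0). \<epsilon> u = 0} = \<phi> (Suc 0) ` free_module (C (Suc 0))"
      using exact_0 by simp
    then show "{u \<in> free_module (B 0). \<epsilon>' u = 0} = \<phi>' 1 ` free_module (B 1)"
      unfolding \<epsilon>'_def One_nat_def by (rule kernel_image)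
    show "{u \<in> free_module (B i). \<phi>' i u = 0} = \<phi>' (Suc i) ` free_module (B (Suc i))" if "1 \<le> i" for i
    proof -
      have "\<phi>' i u = 0 \<longleftrightarrow> \<phi> i (T i u) = 0" for u
      proof
        have "\<phi> i (T i u) \<in> free_module (C (i - 1))"
          using \<phi>_in[OF T_in, of "i - 1" u] that by simp
        then have "\<phi> i (T i u) = T (i - 1) (\<phi>' i u)"
          using TS by (simp add: \<phi>'_def)
        moreover assume "\<phi>' i u = 0"
        ultimately show "\<phi> i (T i u) = 0" using T_0 by simp
      qed (simp add: \<phi>'_def S_0)
      moreover have "{u \<in> free_module (C i). \<phi> i u = 0} = \<phi> (Suc i) ` free_module (C (Suc i))"
        using exact that by simp
      ultimately show ?thesis using kernel_image[of i "\<lambda>u. \<phi> i u = 0"] by simp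
    qed
    show "\<phi>' (Suc i) u b \<in> irrelevant_ideal" for i u b
    proof -
      have "\<phi> (Suc i) (T (Suc i) u) c \<in> irrelevant_ideal" for c
        using minimal T_in by simp
      moreover have "(0 :: ('v, 'k) mpoly) \<in> irrelevant_ideal"
        unfolding irrelevant_ideal_def by (rule ideal_span_zero)
      ultimately show ?thesis by (simp add: \<phi>'_def S_def)
    qed
  qed
  then show ?thesis by blast
qed

text \<open>Each \<open>Cone\<close> lowers r and leaves s unchanged, while no word exists for r = 0
  as long as s > 0. This gives the length r - 1 of the resolution.\<close>

lemma cones_less: "w \<in> words r s \<Longrightarrow> s > 0 \<Longrightarrow> cones w < r"
proof (induction r s arbitrary: w rule: words.induct)
  case (3 r s)
  show ?case
  proof (cases w rule: word_cases)
    case (Skip v)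
    then show ?thesis using "3.prems" "3.IH"(1)[of v] by simp
  next
    case (Mult v)
    then show ?thesis using "3.prems" "3.IH"(2)[of v] by (cases s) simp_all
  next
    case (Cone v)
    then show ?thesis using "3.prems" "3.IH"(3)[of v] by simp
  qed (use 3 in simp)
qed simp_all

section \<open>The iterated cone as a resolution, degree by degree\<close>

definition cone_words :: "nat \<Rightarrow> nat \<Rightarrow> nat \<Rightarrow> step list set" where
  "cone_words r s i = {w \<in> words r s. cones w = i}"

lemma free_module_cone_words:
  "u \<in> free_module (cone_words r s i) \<longleftrightarrow> u \<in> free_module (words r s) \<and> part i u = u"
proof
  assume u: "u \<in> free_module (cone_words r s i)"
  then have "w \<notin> cone_words r s i \<Longrightarrow> u w = 0" for w by (simp add: free_module_def)
  moreover have "w \<in> cone_words r s i \<Longrightarrow> cones w = i" for w by (simp add: cone_words_def)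
  ultimately have "part i u w = u w" for w
    by (cases "w \<in> cone_words r s i") (simp_all add: part_def)
  with u show "u \<in> free_module (words r s) \<and> part i u = u"
    by (auto simp: free_module_def cone_words_def)
next
  assume u: "u \<in> free_module (words r s) \<and> part i u = u"
  show "u \<in> free_module (cone_words r s i)"
    unfolding free_module_def
  proof clarify
    fix w assume "w \<notin> cone_words r s i"
    moreover have "\<And>v. v \<notin> words r s \<Longrightarrow> u v = 0" using u by (simp add: free_module_def)
    ultimately have "part i u w = 0" by (auto simp: part_def cone_words_def)
    then show "u w = 0" using u by metis
  qed
qed

lemma part_idem: "part i (part i u) = part i u"
  by (auto simp: part_def)

lemma part_in_cone_words: "u \<in> free_module (words r s) \<Longrightarrow> part i u \<in> free_module (cone_words r s i)"
  by (simp add: free_module_cone_words part_in_free_module part_idem)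

lemma diff_in_cone_words:
  assumes "u \<in> free_module (cone_words r s (Suc i))"
  shows "diff F r s u \<in> free_module (cone_words r s i)"
proof -
  have "u \<in> free_module (words r s)" "part (Suc i) u = u"
    using assms by (simp_all add: free_module_cone_words)
  then show ?thesis
    using diff_part_Suc[of F r s i u] by (simp add: free_module_cone_words diff_in_free_module)
qed

lemma free_component_cone_words:
  "u \<in> free_component (cone_words r s i) d e \<longleftrightarrow>
     u \<in> free_module (cone_words r s i) \<and> u \<in> free_component (words r s) d e"
  by (auto simp: free_component_def free_module_def cone_words_def)

text \<open>A preimage under \<open>diff\<close> can be projected to degree i + 1 without changing
  its boundary in degree i, so exactness of the total complex restricts to single degrees.\<close>

lemma exact_image:
  assumes "exact_at F r s"
  shows "{u \<in> free_module (cone_words r s i). diff F r s u = (\<lambda>_. 0) \<and> aug F r s u = 0} =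
    diff F r s ` free_module (cone_words r s (Suc i))"
proof (intro equalityI subsetI)
  fix u assume "u \<in> {u \<in> free_module (cone_words r s i). diff F r s u = (\<lambda>_. 0) \<and> aug F r s u = 0}"
  then have u: "u \<in> free_module (words r s)" "part i u = u" "diff F r s u = (\<lambda>_. 0)" "aug F r s u = 0"
    by (simp_all add: free_module_cone_words)
  then obtain w where w: "w \<in> free_module (words r s)" "diff F r s w = u"
    using assms unfolding exact_at_def by blast
  then have "u = diff F r s (part (Suc i) w)" by (simp add: diff_part_Suc u)
  then show "u \<in> diff F r s ` free_module (cone_words r s (Suc i))"
    using part_in_cone_words[OF w(1)] by (rule image_eqI)
next
  fix u assume "u \<in> diff F r s ` free_module (cone_words r s (Suc i))"
  then obtain w where "w \<in> free_module (cone_words r s (Suc i))" "u = diff F r s w" by blast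
  then show "u \<in> {u \<in> free_module (cone_words r s i). diff F r s u = (\<lambda>_. 0) \<and> aug F r s u = 0}"
    by (simp add: diff_in_cone_words diff_diff aug_diff)
qed

text \<open>Since \<open>diff\<close> acts on the total complex, the same map is the differential in
  every degree.\<close>

lemma words_resolution:
  fixes F :: "nat \<Rightarrow> ('v::finite, 'k::field) mpoly"
  assumes "s > 0"
    and regular: "\<And>j g. j < r \<Longrightarrow> F j * g \<in> initial_ideal F j \<Longrightarrow> g \<in> initial_ideal F j"
    and forms: "\<And>j. j < r \<Longrightarrow> F j \<in> forms (int (\<delta> j))"
    and irrelevant: "\<And>j. j < r \<Longrightarrow> F j \<in> irrelevant_ideal"
  shows "minimal_graded_free_resolution (r - 1) (cone_words r s) (\<lambda>_. weight r \<delta> r)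
    (\<lambda>_. diff F r s) (aug F r s) (ideal_power (initial_ideal F r) s)"
  unfolding minimal_graded_free_resolution_def
proof (intro conjI allI impI ballI)
  show "finite (cone_words r s i)" for i
    by (simp add: cone_words_def finite_words)
  show "cone_words r s i = {}" if "i > r - 1" for i
    using that cones_less[of _ r s] assms(1) by (force simp: cone_words_def)
  show "graded_hom
      free_scale (free_module (cone_words r s (Suc i))) (free_component (cone_words r s (Suc i)) (weight r \<delta> r))
      free_scale (free_module (cone_words r s i)) (free_component (cone_words r s i) (weight r \<delta> r))
      (diff F r s)" for i
  proof (rule graded_homI)
    fix e and u :: "step list \<Rightarrow> ('v, 'k) mpoly"
    assume "u \<in> free_component (cone_words r s (Suc i)) (weight r \<delta> r) e"
    then show "diff F r s u \<in> free_component (cone_words r s i) (weight r \<delta> r) e"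
      using diff_component[OF forms le_refl] diff_in_cone_words
      by (auto simp: free_component_cone_words)
  qed (simp_all add: diff_in_cone_words free_scale_def diff_scale plus_fun_def diff_add)
  have aug_cone_words: "aug F r s ` free_module (cone_words r s 0) = ideal_power (initial_ideal F r) s"
    unfolding aug_image[symmetric]
  proof (intro equalityI subsetI)
    fix p assume "p \<in> aug F r s ` free_module (words r s)"
    then obtain u where u: "u \<in> free_module (words r s)" "p = aug F r s u" by blast
    then have "p = aug F r s (part 0 u)" by (simp add: aug_part_0)
    then show "p \<in> aug F r s ` free_module (cone_words r s 0)"
      using part_in_cone_words[OF u(1)] by (rule image_eqI)
  qed (auto simp: free_module_cone_words)
  then show "aug F r s ` free_module (cone_words r s 0) = ideal_power (initial_ideal F r) s" .
  show "graded_hom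
      free_scale (free_module (cone_words r s 0)) (free_component (cone_words r s 0) (weight r \<delta> r))
      (*) (ideal_power (initial_ideal F r) s) (\<lambda>e. ideal_power (initial_ideal F r) s \<inter> forms e)
      (aug F r s)"
  proof (rule graded_homI)
    fix e and u :: "step list \<Rightarrow> ('v, 'k) mpoly"
    assume u: "u \<in> free_component (cone_words r s 0) (weight r \<delta> r) e"
    then have "aug F r s u \<in> forms e"
      using aug_component[OF forms le_refl] by (simp add: free_component_cone_words)
    moreover have "aug F r s u \<in> ideal_power (initial_ideal F r) s"
      using u unfolding aug_cone_words[symmetric] free_component_cone_words by blast
    ultimately show "aug F r s u \<in> ideal_power (initial_ideal F r) s \<inter> forms e" by blast
  next
    fix u :: "step list \<Rightarrow> ('v, 'k) mpoly" assume "u \<in> free_module (cone_words r s 0)"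
    then show "aug F r s u \<in> ideal_power (initial_ideal F r) s"
      unfolding aug_cone_words[symmetric] by blast
  qed (simp_all add: free_scale_def aug_scale plus_fun_def aug_add)
  have exact: "exact_at F r s" by (rule exact_at_if_regular[OF regular])
  have "diff F r s u = (\<lambda>_. 0)" if "u \<in> free_module (cone_words r s 0)" for u
    using that diff_part_0[of F r s u] by (simp add: free_module_cone_words)
  then show "{u \<in> free_module (cone_words r s 0). aug F r s u = 0} =
      diff F r s ` free_module (cone_words r s 1)"
    using exact_image[OF exact, of 0] by auto
  show "{u \<in> free_module (cone_words r s i). diff F r s u = 0} =
      diff F r s ` free_module (cone_words r s (Suc i))" if "1 \<le> i" for i
  proof -
    \<comment> \<open>The augmentation reads only words without \<open>Cone\<close>, where u
      vanishes because i >= 1.\<close>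
    have "aug F r s u = 0" if u: "u \<in> free_module (cone_words r s i)" for u :: "step list \<Rightarrow> ('v, 'k) mpoly"
    proof -
      have "part i u = u" using u by (simp add: free_module_cone_words)
      moreover have "part i u v = 0" if "cones v = 0" for v
        using that \<open>1 \<le> i\<close> by (simp add: part_def)
      ultimately have "u v = 0" if "cones v = 0" for v using that by metis
      then have "aug F r s u = aug F r s (\<lambda>_. 0)" by (rule aug_local)
      then show ?thesis by simp
    qed
    then show ?thesis
      unfolding exact_image[OF exact, symmetric] zero_fun_def by blast
  qed
  show "diff F r s u b \<in> irrelevant_ideal" for u b
    unfolding irrelevant_ideal_def
    by (rule diff_in_ideal[OF ideal_subspace_span])
      (use irrelevant in \<open>simp add: irrelevant_ideal_def\<close>)
qed

section \<open>Powers of a complete intersection\<close>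

theorem theorem2p1:
  fixes Fs :: "('v::finite, 'k::field_char_0) mpoly list"
    and ds :: "nat list"
    and r s :: nat
  assumes "length Fs = r" and "r \<ge> 1" and "s \<ge> 1"
    and "complete_intersection Fs ds"
  shows "\<exists>\<phi> \<epsilon>. minimal_graded_free_resolution (r - 1) (H_index r s) (\<lambda>i. H_degree ds) \<phi> \<epsilon>
                (ideal_power (ideal_span (set Fs)) s)"
proof -
  have len: "length ds = r" and reg: "regular_sequence Fs"
    and forms: "\<And>j. j < r \<Longrightarrow> Fs ! j \<in> forms (int (ds ! j))"
    using assms by (auto simp: complete_intersection_def)
  have ideal: "initial_ideal ((!) Fs) j = ideal_span (set (take j Fs))" if "j \<le> r" for j
    using nth_image[of j Fs] that assms(1) by (simp add: lessThan_atLeast0)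
  have regular: "g \<in> initial_ideal ((!) Fs) j"
    if "j < r" "Fs ! j * g \<in> initial_ideal ((!) Fs) j" for j g
    using reg that ideal[of j] assms(1) unfolding regular_sequence_def by (metis less_imp_le)
  have irrelevant: "Fs ! j \<in> irrelevant_ideal" if j: "j < r" for j
  \<comment> \<open>A nonzero form of degree 0 would be a unit in the ideal, which is proper;
    otherwise the form is 0 or has positive degree.\<close>
  proof (cases "ds ! j = 0 \<and> Fs ! j \<noteq> 0")
    case True
    then obtain q where "q * Fs ! j = 1"
      using forms_0_unit[of "Fs ! j"] forms[OF j] by auto
    moreover have "Fs ! j \<in> ideal_span (set Fs)"
      using j assms(1) by (intro ideal_span_base) simp
    ultimately have "1 \<in> ideal_span (set Fs)" by (metis ideal_span_scale)
    then have "x * 1 \<in> ideal_span (set Fs)" for x by (rule ideal_span_scale)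
    then show ?thesis using reg by (auto simp: regular_sequence_def)
  next
    case False
    then show ?thesis
      using forms_in_irrelevant_ideal[OF forms[OF j]]
      by (cases "Fs ! j = 0") (auto simp: irrelevant_ideal_def ideal_span_zero)
  qed
  have res: "minimal_graded_free_resolution (r - 1) (cone_words r s) (\<lambda>_. weight r ((!) ds) r)
    (\<lambda>_. diff ((!) Fs) r s) (aug ((!) Fs) r s) (ideal_power (ideal_span (set Fs)) s)"
  proof -
    have "initial_ideal ((!) Fs) r = ideal_span (set Fs)" using ideal[of r] assms(1) by simp
    moreover have "s > 0" using assms(3) by simp
    ultimately show ?thesis
      using words_resolution[where F = "(!) Fs" and \<delta> = "(!) ds", OF _ regular forms irrelevant] by metis
  qed
  \<comment> \<open>The fibres over each exponent list have the same size on both sides, so the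
    bijection can be chosen to respect exponents and therefore degrees.\<close>
  have "\<exists>h. bij_betw h (H_index r s i) (cone_words r s i) \<and>
      (\<forall>x\<in>H_index r s i. expo_list r (h x) = snd x)" for i
  proof -
    have card: "card {x \<in> H_index r s i. snd x = a} = card {w \<in> cone_words r s i. expo_list r w = a}" for a
      using card_H_index_fibre[of s r i a] card_expo_list_fibre[of s r i a] assms(3)
      by (simp add: cone_words_def conj_assoc)
    have fin: "finite (cone_words r s i)" by (simp add: cone_words_def finite_words)
    obtain h where "bij_betw h (H_index r s i) (cone_words r s i)"
      "\<And>x. x \<in> H_index r s i \<Longrightarrow> expo_list r (h x) = snd x"
      using bij_betw_of_card_fibres[OF finite_H_index fin card] by blast
    then show ?thesis by blast
  qed
  then obtain h where h: "\<And>i. bij_betw (h i) (H_index r s i) (cone_words r s i)"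
    "\<And>i x. x \<in> H_index r s i \<Longrightarrow> expo_list r (h i x) = snd x" by metis
  have "H_degree ds x = weight r ((!) ds) r (h i x)" if "x \<in> H_index r s i" for i x
  proof -
    have "snd x ! j = expo r (h i x) j" if "j < r" for j
      unfolding h(2)[OF \<open>x \<in> H_index r s i\<close>, symmetric] using that by (simp add: expo_list_def)
    then show ?thesis by (simp add: H_degree_def weight_def len case_prod_beta)
  qed
  from minimal_graded_free_resolution_reindex[OF h(1) this res] show ?thesis .
qed

end
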